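(* Let $k\ge 2$ be an integer and let $X\subseteq \mathbb{N}$ be a $k$-automatic set that is not eventually periodic. Then either every $k$-automatic subset of $\mathbb{N}$ is definable in the structure $(\mathbb{N},+,X)$, or $X$ is definable in the structure $(\mathbb{N},+,k^{\mathbb{N}})$.
   Context: $\mathbb{N}$ includes $0$. $\Sigma_k=\{0,\dots,k-1\}$; for a word $w=w_nw_{n-1}\cdots w_0\in\Sigma_k^*$ (most significant digit first, leading zeros allowed), $[w]_k=\sum_{i=0}^n w_ik^i$ (and the empty word has value $0$). For $L\subseteq\Sigma_k^*$, $[L]_k=\{[w]_k : w\in L\}$. A set $X\subseteq\mathbb{N}$ is $k$-automatic if $X=[L]_k$ for some regular language $L\subseteq\Sigma_k^*$. A set $X\subseteq \mathbb{N}$ is eventually periodic if there are $N\in\mathbb{N}$ and $p\ge 1$ such that for all $n\ge N$: $n\in X\iff n+p\in X$. $k^{\mathbb{N}}=\{k^n : n\in\mathbb{N}\}$. Definable means first-order definable; $(\mathbb{N},+,Z)$ denotes the structure with universe $\mathbb{N}$, addition, and a unary predicate for $Z\subseteq\mathbb{N}$. *)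

theory Defs
  imports Main
begin

text \<open>First-order logic over the language with equality, a binary function symbol \<open>+\<close>
  and one unary predicate symbol. Variables are named by natural numbers.\<close>

datatype trm = Var nat | Plus trm trm

datatype form =
    Eq trm trm
  | Pred trm
  | Neg form
  | Conj form form
  | Exi nat form

primrec vars_trm :: "trm \<Rightarrow> nat set" where
  "vars_trm (Var x) = {x}"
| "vars_trm (Plus s t) = vars_trm s \<union> vars_trm t"

primrec free_vars :: "form \<Rightarrow> nat set" where
  "free_vars (Eq s t) = vars_trm s \<union> vars_trm t"
| "free_vars (Pred t) = vars_trm t"
| "free_vars (Neg \<phi>) = free_vars \<phi>"
| "free_vars (Conj \<phi> \<psi>) = free_vars \<phi> \<union> free_vars \<psi>"
| "free_vars (Exi x \<phi>) = free_vars \<phi> - {x}"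

primrec val_trm :: "(nat \<Rightarrow> nat) \<Rightarrow> trm \<Rightarrow> nat" where
  "val_trm e (Var x) = e x"
| "val_trm e (Plus s t) = val_trm e s + val_trm e t"

text \<open>\<open>sat Z e \<phi>\<close>: the structure \<open>(\<nat>, +, Z)\<close> satisfies \<open>\<phi>\<close> under the assignment \<open>e\<close>.\<close>

primrec sat :: "nat set \<Rightarrow> (nat \<Rightarrow> nat) \<Rightarrow> form \<Rightarrow> bool" where
  "sat Z e (Eq s t) \<longleftrightarrow> val_trm e s = val_trm e t"
| "sat Z e (Pred t) \<longleftrightarrow> val_trm e t \<in> Z"
| "sat Z e (Neg \<phi>) \<longleftrightarrow> \<not> sat Z e \<phi>"
| "sat Z e (Conj \<phi> \<psi>) \<longleftrightarrow> sat Z e \<phi> \<and> sat Z e \<psi>"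
| "sat Z e (Exi x \<phi>) \<longleftrightarrow> (\<exists>n. sat Z (e(x := n)) \<phi>)"

text \<open>\<open>definable_in Z Y\<close>: \<open>Y\<close> is definable in \<open>(\<nat>, +, Z)\<close>. Parameters are omitted without loss,
  as every natural number is definable in \<open>(\<nat>, +)\<close>.\<close>

definition definable_in :: "nat set \<Rightarrow> nat set \<Rightarrow> bool" where
  "definable_in Z Y \<longleftrightarrow>
     (\<exists>\<phi>. free_vars \<phi> \<subseteq> {0} \<and> (\<forall>e. sat Z e \<phi> \<longleftrightarrow> e 0 \<in> Y))"

text \<open>A word over \<open>\<Sigma>\<^sub>k\<close> is an element of \<open>lists {..<k}\<close>, with the most significant digit at the head
  of the list. Regularity is recognizability by a complete deterministic finite automaton; taking
  natural numbers as states is no restriction, since the state set is finite.\<close>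

definition regular_lang :: "nat \<Rightarrow> nat list set \<Rightarrow> bool" where
  "regular_lang k L \<longleftrightarrow>
     (\<exists>(Q :: nat set) q0 (\<delta> :: nat \<Rightarrow> nat \<Rightarrow> nat) F.
        finite Q \<and> q0 \<in> Q \<and> F \<subseteq> Q \<and> (\<forall>q\<in>Q. \<forall>a<k. \<delta> q a \<in> Q) \<and>
        L = {w \<in> lists {..<k}. foldl \<delta> q0 w \<in> F})"

definition word_val :: "nat \<Rightarrow> nat list \<Rightarrow> nat" where
  "word_val k w = (\<Sum>i<length w. rev w ! i * k ^ i)"

definition k_automatic :: "nat \<Rightarrow> nat set \<Rightarrow> bool" where
  "k_automatic k X \<longleftrightarrow> (\<exists>L. regular_lang k L \<and> X = word_val k ` L)"

definition eventually_periodic :: "nat set \<Rightarrow> bool" where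
  "eventually_periodic X \<longleftrightarrow> (\<exists>N. \<exists>p\<ge>1. \<forall>n\<ge>N. n \<in> X \<longleftrightarrow> n + p \<in> X)"

end

theory Submission
  imports Defs
begin

text \<open>
  After passing to a power \<open>K\<close> of \<open>k\<close>, the blocks of length \<open>K\<close> of \<open>X\<close> give a sequence \<open>s\<close> over a
  finite alphabet that is interdefinable with \<open>X\<close> and fixed by an injective \<open>K\<close>-uniform substitution.
  Consider the letters \<open>q\<close> whose iterated images do not have a common period.

  If each of them occurs at most once in each of its own iterated images, then an occurrence of a
  letter in an image of \<open>q\<close> is reached by a run of a single digit, another digit, and a step down in the
  reachability order; by induction \<open>s\<close> is definable from the powers of \<open>K\<close>.

  Otherwise some such \<open>q\<close> occurs twice in one of its images. By pigeonhole the \<open>n\<close>-th image of \<open>q\<close> has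
  no period much smaller than its length, so a counting argument shows that its occurrences in \<open>s\<close> are
  exactly the \<open>K\<close>-fold multiples of those of the previous image, for large \<open>n\<close>. As \<open>q\<close> occurs twice in its
  image, boundedly many differences of occurrences add up to all multiples of some \<open>K ^ i * g\<close>. This
  makes divisibility by certain \<open>v\<close>, among them all \<open>K ^ i * g\<close>, definable from \<open>X\<close>. The kernel of this
  divisibility relation is finite, which by a pumping argument leaves only \<open>v\<close> of the form \<open>u * K ^ i\<close>
  with bounded \<open>u\<close>, and a congruence singles out the powers of a power of \<open>K\<close>. Divisibility by these
  gives access to digits, and hence to runs of automata.
\<close>

section \<open>Definable relations and functions\<close>

lemma finite_vars_trm: "finite (vars_trm t)"
  by (induction t) auto

lemma finite_free_vars: "finite (free_vars \<phi>)"
  by (induction \<phi>) (auto simp: finite_vars_trm)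

lemma val_trm_cong: "(\<And>x. x \<in> vars_trm t \<Longrightarrow> e x = e' x) \<Longrightarrow> val_trm e t = val_trm e' t"
  by (induction t) auto

lemma sat_cong: "(\<And>x. x \<in> free_vars \<phi> \<Longrightarrow> e x = e' x) \<Longrightarrow> sat Z e \<phi> \<longleftrightarrow> sat Z e' \<phi>"
proof (induction \<phi> arbitrary: e e')
  case (Eq s t)
  then have "val_trm e s = val_trm e' s" "val_trm e t = val_trm e' t"
    by (auto intro: val_trm_cong)
  then show ?case by simp
next
  case (Pred t)
  then have "val_trm e t = val_trm e' t"
    by (auto intro: val_trm_cong)
  then show ?case by simp
next
  case (Neg \<phi>)
  show ?case using Neg.IH[of e e'] Neg.prems by simp
next
  case (Conj \<phi> \<psi>)
  show ?case using Conj.IH(1)[of e e'] Conj.IH(2)[of e e'] Conj.prems by simp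
next
  case (Exi x \<phi>)
  have "sat Z (e(x := n)) \<phi> = sat Z (e'(x := n)) \<phi>" for n
    by (rule Exi.IH) (use Exi.prems in auto)
  then show ?case by simp
qed

section \<open>Renaming of variables without capture\<close>

primrec ren_trm :: "(nat \<Rightarrow> nat) \<Rightarrow> trm \<Rightarrow> trm" where
  "ren_trm f (Var x) = Var (f x)"
| "ren_trm f (Plus s t) = Plus (ren_trm f s) (ren_trm f t)"

definition fresh :: "nat set \<Rightarrow> nat" where
  "fresh A = (SOME y. y \<notin> A)"

lemma fresh_notin: "finite A \<Longrightarrow> fresh A \<notin> A"
  unfolding fresh_def by (rule someI_ex) (rule ex_new_if_finite[OF infinite_UNIV_nat])

text \<open>The new bound variable lies outside the image of the free variables of the body, so the
  renaming is sound for every \<open>f\<close>, injective or not.\<close>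

primrec ren :: "(nat \<Rightarrow> nat) \<Rightarrow> form \<Rightarrow> form" where
  "ren f (Eq s t) = Eq (ren_trm f s) (ren_trm f t)"
| "ren f (Pred t) = Pred (ren_trm f t)"
| "ren f (Neg \<phi>) = Neg (ren f \<phi>)"
| "ren f (Conj \<phi> \<psi>) = Conj (ren f \<phi>) (ren f \<psi>)"
| "ren f (Exi x \<phi>) = (let y = fresh (f ` free_vars \<phi>) in Exi y (ren (f(x := y)) \<phi>))"

lemma val_ren_trm: "val_trm e (ren_trm f t) = val_trm (\<lambda>i. e (f i)) t"
  by (induction t) auto

lemma vars_ren_trm: "vars_trm (ren_trm f t) = f ` vars_trm t"
  by (induction t) auto

lemma sat_ren: "sat Z e (ren f \<phi>) \<longleftrightarrow> sat Z (\<lambda>i. e (f i)) \<phi>"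
proof (induction \<phi> arbitrary: e f)
  case (Exi x \<phi>)
  define y where "y = fresh (f ` free_vars \<phi>)"
  have y: "y \<notin> f ` free_vars \<phi>"
    unfolding y_def by (simp add: fresh_notin finite_free_vars)
  have "sat Z (e(y := n)) (ren (f(x := y)) \<phi>) = sat Z ((\<lambda>i. e (f i))(x := n)) \<phi>" for n
    unfolding Exi.IH by (rule sat_cong) (use y in auto)
  then show ?case by (simp flip: y_def)
qed (auto simp: val_ren_trm)

lemma free_vars_ren: "free_vars (ren f \<phi>) \<subseteq> f ` free_vars \<phi>"
proof (induction \<phi> arbitrary: f)
  case (Exi x \<phi>)
  define y where "y = fresh (f ` free_vars \<phi>)"
  have "free_vars (ren (f(x := y)) \<phi>) \<subseteq> (f(x := y)) ` free_vars \<phi>"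
    by (rule Exi.IH)
  also have "\<dots> \<subseteq> insert y (f ` (free_vars \<phi> - {x}))"
    by auto
  finally show ?case by (auto simp flip: y_def)
qed (simp_all add: vars_ren_trm image_Un le_supI1 le_supI2)

text \<open>Nothing is asked of the free variables, so that arities need not be tracked.\<close>

definition definable_rel :: "nat set \<Rightarrow> ((nat \<Rightarrow> nat) \<Rightarrow> bool) \<Rightarrow> bool" where
  "definable_rel Z P \<longleftrightarrow> (\<exists>\<phi>. \<forall>e. sat Z e \<phi> \<longleftrightarrow> P e)"

text \<open>The graph has its value in variable \<open>0\<close> and the arguments shifted up by one.\<close>

definition definable_fun :: "nat set \<Rightarrow> ((nat \<Rightarrow> nat) \<Rightarrow> nat) \<Rightarrow> bool" where
  "definable_fun Z t \<longleftrightarrow> definable_rel Z (\<lambda>e. e 0 = t (\<lambda>i. e (Suc i)))"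

text \<open>The truth value depends on \<open>e 0\<close> alone, so all free variables may be
  renamed to \<open>0\<close>.\<close>

lemma definable_in_if_definable_rel:
  assumes "definable_rel Z (\<lambda>e. e 0 \<in> Y)"
  shows "definable_in Z Y"
proof -
  obtain \<phi> where \<phi>: "\<And>e. sat Z e \<phi> \<longleftrightarrow> e 0 \<in> Y"
    using assms unfolding definable_rel_def by blast
  have "free_vars (ren (\<lambda>_. 0) \<phi>) \<subseteq> {0}"
    using free_vars_ren[of "\<lambda>_. 0" \<phi>] by auto
  moreover have "\<forall>e. sat Z e (ren (\<lambda>_. 0) \<phi>) \<longleftrightarrow> e 0 \<in> Y"
    by (simp add: sat_ren \<phi>)
  ultimately show ?thesis unfolding definable_in_def by blast
qed

section \<open>Closure properties of definable relations\<close>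

lemma definable_rel_ren:
  assumes "definable_rel Z P"
  shows "definable_rel Z (\<lambda>e. P (\<lambda>i. e (f i)))"
proof -
  obtain \<phi> where "\<forall>e. sat Z e \<phi> \<longleftrightarrow> P e"
    using assms unfolding definable_rel_def by blast
  then have "\<forall>e. sat Z e (ren f \<phi>) \<longleftrightarrow> P (\<lambda>i. e (f i))"
    by (simp add: sat_ren)
  then show ?thesis unfolding definable_rel_def ..
qed

lemma definable_rel_cong: "definable_rel Z P \<Longrightarrow> (\<And>e. P e \<longleftrightarrow> Q e) \<Longrightarrow> definable_rel Z Q"
  by (simp add: ext[of P Q])

lemma definable_rel_not:
  assumes "definable_rel Z P"
  shows "definable_rel Z (\<lambda>e. \<not> P e)"
proof -
  obtain \<phi> where "\<forall>e. sat Z e \<phi> \<longleftrightarrow> P e"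
    using assms unfolding definable_rel_def by blast
  then have "\<forall>e. sat Z e (Neg \<phi>) \<longleftrightarrow> \<not> P e"
    by simp
  then show ?thesis unfolding definable_rel_def ..
qed

lemma definable_rel_conj:
  assumes "definable_rel Z P" "definable_rel Z Q"
  shows "definable_rel Z (\<lambda>e. P e \<and> Q e)"
proof -
  obtain \<phi> \<psi> where "\<forall>e. sat Z e \<phi> \<longleftrightarrow> P e" "\<forall>e. sat Z e \<psi> \<longleftrightarrow> Q e"
    using assms unfolding definable_rel_def by blast
  then have "\<forall>e. sat Z e (Conj \<phi> \<psi>) \<longleftrightarrow> P e \<and> Q e"
    by simp
  then show ?thesis unfolding definable_rel_def ..
qed

lemma definable_rel_disj: "definable_rel Z P \<Longrightarrow> definable_rel Z Q \<Longrightarrow> definable_rel Z (\<lambda>e. P e \<or> Q e)"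
  using definable_rel_not[OF definable_rel_conj[OF definable_rel_not[of Z P] definable_rel_not[of Z Q]]] by simp

lemma definable_rel_imp: "definable_rel Z P \<Longrightarrow> definable_rel Z Q \<Longrightarrow> definable_rel Z (\<lambda>e. P e \<longrightarrow> Q e)"
  unfolding imp_conv_disj by (rule definable_rel_disj[OF definable_rel_not])

lemma definable_rel_iff: "definable_rel Z P \<Longrightarrow> definable_rel Z Q \<Longrightarrow> definable_rel Z (\<lambda>e. P e \<longleftrightarrow> Q e)"
  unfolding iff_conv_conj_imp by (intro definable_rel_conj definable_rel_imp)

lemma definable_rel_const: "definable_rel Z (\<lambda>e. c)"
proof -
  have "definable_rel Z (\<lambda>e. e 0 = e 0)"
    unfolding definable_rel_def by (rule exI[of _ "Eq (Var 0) (Var 0)"]) simp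
  then show ?thesis
    using definable_rel_not[of Z "\<lambda>e. True"] by (cases c) simp_all
qed

text \<open>The bound variable becomes variable \<open>0\<close> and the others are shifted up, so that the rules apply
  by unification to relations written with the quantifiers of HOL.\<close>

lemma definable_rel_ex:
  assumes "definable_rel Z (\<lambda>e. P (e 0) (\<lambda>i. e (Suc i)))"
  shows "definable_rel Z (\<lambda>e. \<exists>n. P n e)"
proof -
  obtain \<phi> where \<phi>: "\<And>e. sat Z e \<phi> \<longleftrightarrow> P (e 0) (\<lambda>i. e (Suc i))"
    using assms unfolding definable_rel_def by blast
  \<comment> \<open>The renaming sends \<open>Suc i\<close> to \<open>i\<close> and \<open>0\<close>
    to \<open>y\<close>, so \<open>y\<close> must not be the predecessor of a free variable.\<close>
  define y where "y = fresh ((\<lambda>i. i - 1) ` free_vars \<phi>)"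
  have y: "y \<notin> (\<lambda>i. i - 1) ` free_vars \<phi>"
    unfolding y_def by (simp add: fresh_notin finite_free_vars)
  have "sat Z (e(y := n)) (ren (case_nat y id) \<phi>) \<longleftrightarrow> P n e" for e n
  proof -
    have "sat Z (e(y := n)) (ren (case_nat y id) \<phi>) \<longleftrightarrow> sat Z (case_nat n e) \<phi>"
      unfolding sat_ren by (rule sat_cong) (use y in \<open>force split: nat.splits\<close>)
    then show ?thesis by (simp add: \<phi>)
  qed
  then have "\<forall>e. sat Z e (Exi y (ren (case_nat y id) \<phi>)) \<longleftrightarrow> (\<exists>n. P n e)"
    by simp
  then show ?thesis unfolding definable_rel_def by blast
qed

lemma definable_rel_all:
  assumes "definable_rel Z (\<lambda>e. P (e 0) (\<lambda>i. e (Suc i)))"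
  shows "definable_rel Z (\<lambda>e. \<forall>n. P n e)"
  using definable_rel_not[OF definable_rel_ex[of Z "\<lambda>n e. \<not> P n e", OF definable_rel_not[OF assms]]] by simp

lemma definable_rel_ball_finite:
  assumes "finite I" "\<And>i. i \<in> I \<Longrightarrow> definable_rel Z (P i)"
  shows "definable_rel Z (\<lambda>e. \<forall>i\<in>I. P i e)"
  using assms by (induction I rule: finite_induct) (simp_all add: definable_rel_const definable_rel_conj)

lemma definable_rel_bex_finite:
  assumes "finite I" "\<And>i. i \<in> I \<Longrightarrow> definable_rel Z (P i)"
  shows "definable_rel Z (\<lambda>e. \<exists>i\<in>I. P i e)"
  using assms by (induction I rule: finite_induct) (simp_all add: definable_rel_const definable_rel_disj)

lemma definable_fun_ren: "definable_fun Z t \<Longrightarrow> definable_fun Z (\<lambda>e. t (\<lambda>i. e (f i)))"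
  unfolding definable_fun_def
  using definable_rel_ren[of Z "\<lambda>e. e 0 = t (\<lambda>i. e (Suc i))" "case_nat 0 (\<lambda>i. Suc (f i))"] by simp

lemma definable_fun_var: "definable_fun Z (\<lambda>e. e i)"
  unfolding definable_fun_def definable_rel_def by (rule exI[of _ "Eq (Var 0) (Var (Suc i))"]) simp

text \<open>The value is quantified and described by its graph, so functions that are not terms of
  the language, such as constants, may be arguments.\<close>

lemma definable_rel_subst:
  assumes "definable_rel Z (\<lambda>e. P (e 0) (\<lambda>i. e (Suc i)))" "definable_fun Z t"
  shows "definable_rel Z (\<lambda>e. P (t e) e)"
proof -
  have "definable_rel Z (\<lambda>e. \<exists>n. n = t e \<and> P n e)"
    by (intro definable_rel_ex definable_rel_conj assms(1)) (use assms(2) in \<open>simp add: definable_fun_def\<close>)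
  then show ?thesis by simp
qed

lemma definable_rel_eq: "definable_fun Z t \<Longrightarrow> definable_fun Z u \<Longrightarrow> definable_rel Z (\<lambda>e. t e = u e)"
  by (rule definable_rel_subst[of Z "\<lambda>n e. n = u e" t]) (simp_all add: definable_fun_def)

lemma definable_rel_mem: "definable_fun Z t \<Longrightarrow> definable_rel Z (\<lambda>e. t e \<in> Z)"
  by (rule definable_rel_subst[of Z "\<lambda>n e. n \<in> Z" t], unfold definable_rel_def)
     (auto intro!: exI[of _ "Pred (Var 0)"])

lemma definable_fun_add:
  assumes "definable_fun Z t" "definable_fun Z u"
  shows "definable_fun Z (\<lambda>e. t e + u e)"
proof -
  have *: "definable_rel Z (\<lambda>e. e 2 = e 1 + e 0)"
    unfolding definable_rel_def by (rule exI[of _ "Eq (Var 2) (Plus (Var 1) (Var 0))"]) simp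
  have "definable_rel Z (\<lambda>e. e 1 = e 0 + u (\<lambda>i. e (Suc (Suc i))))"
    by (rule definable_rel_subst[of Z "\<lambda>n e. e 1 = e 0 + n"])
       (use * definable_fun_ren[OF assms(2)] in \<open>simp_all add: numeral_2_eq_2\<close>)
  then have "definable_rel Z (\<lambda>e. e 0 = t (\<lambda>i. e (Suc i)) + u (\<lambda>i. e (Suc i)))"
    using definable_rel_subst[of Z "\<lambda>n e. e 0 = n + u (\<lambda>i. e (Suc i))" "\<lambda>e. t (\<lambda>i. e (Suc i))"]
      definable_fun_ren[OF assms(1)] by simp
  then show ?thesis unfolding definable_fun_def .
qed

lemma definable_rel_le:
  assumes "definable_fun Z t" "definable_fun Z u"
  shows "definable_rel Z (\<lambda>e. t e \<le> u e)"
proof -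
  have "definable_rel Z (\<lambda>e. \<exists>n. u e = t e + n)"
    by (intro definable_rel_ex definable_rel_eq definable_fun_add definable_fun_var assms[THEN definable_fun_ren])
  then show ?thesis by (simp add: le_iff_add)
qed

lemma definable_rel_less: "definable_fun Z t \<Longrightarrow> definable_fun Z u \<Longrightarrow> definable_rel Z (\<lambda>e. t e < u e)"
  using definable_rel_not[OF definable_rel_le[of Z u t]] by (simp add: not_le)

lemma definable_fun_const: "definable_fun Z (\<lambda>e. c)"
proof (induction c)
  case 0
  have "definable_rel Z (\<lambda>e. \<forall>n. e 0 \<le> n)"
    by (rule definable_rel_all, rule definable_rel_le, rule definable_fun_var, rule definable_fun_var)
  moreover have "(\<forall>n. m \<le> n) = (m = 0)" for m :: nat
    by (metis le_zero_eq zero_le)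
  ultimately show ?case unfolding definable_fun_def by (simp only:)
next
  case (Suc c)
  have "definable_rel Z (\<lambda>e. c < e 0 \<and> (\<forall>n. c < n \<longrightarrow> e 0 \<le> n))"
    by (rule definable_rel_conj, rule definable_rel_less, rule Suc, rule definable_fun_var, rule definable_rel_all, rule definable_rel_imp,
        rule definable_rel_less, rule Suc, rule definable_fun_var, rule definable_rel_le, rule definable_fun_var, rule definable_fun_var)
  moreover have "(c < m \<and> (\<forall>n. c < n \<longrightarrow> m \<le> n)) = (m = Suc c)" for m
    by (metis Suc_leI lessI le_antisym)
  ultimately show ?case unfolding definable_fun_def by (simp only:)
qed

lemma definable_fun_cmult: "definable_fun Z t \<Longrightarrow> definable_fun Z (\<lambda>e. c * t e)"
  by (induction c) (simp_all add: definable_fun_const definable_fun_add)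

lemma definable_rel_mod:
  assumes "definable_fun Z t" "c > 0"
  shows "definable_rel Z (\<lambda>e. t e mod c = d)"
proof -
  have "definable_rel Z (\<lambda>e. \<exists>n. t e = c * n + d \<and> d < c)"
    by (intro definable_rel_ex definable_rel_conj definable_rel_eq definable_fun_add definable_fun_cmult definable_fun_var definable_fun_const definable_rel_const assms(1)[THEN definable_fun_ren])
  moreover have "(\<exists>n. m = c * n + d \<and> d < c) \<longleftrightarrow> m mod c = d" for m
    using assms(2) by (auto intro!: exI[of _ "m div c"])
  ultimately show ?thesis by simp
qed

lemmas definable_intros = definable_rel_not definable_rel_conj definable_rel_disj definable_rel_imp definable_rel_iff definable_rel_ex definable_rel_all definable_rel_eq definable_rel_le definable_rel_less
  definable_fun_add definable_fun_cmult definable_fun_var definable_fun_const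

section \<open>Kernels\<close>

text \<open>The classical \<open>b\<close>-kernel of the characteristic sequence. Automaticity
  enters the proof only through its finiteness.\<close>

definition kernel :: "nat \<Rightarrow> nat set \<Rightarrow> (nat \<Rightarrow> bool) set" where
  "kernel b X = {\<lambda>a. b ^ j * a + r \<in> X | j r. r < b ^ j}"

lemma kernel_power: "kernel (b ^ m) X \<subseteq> kernel b X"
  unfolding kernel_def by (auto simp flip: power_mult)

section \<open>Finiteness of kernels of definable relations\<close>

lemma val_trm_affine:
  "val_trm (\<lambda>v. B * e v + r v) t = B * val_trm e t + val_trm r t"
  by (induction t) (auto simp: algebra_simps)

text \<open>Bounds the carry that the low digits \<open>r\<close> can produce in a term,
  independently of \<open>B\<close>.\<close>

lemma val_trm_bound: "\<exists>m. \<forall>B r. (\<forall>v. r v < B) \<longrightarrow> val_trm r t < m * B"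
proof (induction t)
  case (Var x)
  show ?case by (rule exI[of _ 1]) simp
next
  case (Plus t u)
  then obtain m m' where "\<forall>B r. (\<forall>v. r v < B) \<longrightarrow> val_trm r t < m * B"
    "\<forall>B r. (\<forall>v. r v < B) \<longrightarrow> val_trm r u < m' * B"
    by blast
  then show ?case
    by (intro exI[of _ "m + m'"]) (auto simp: add_mult_distrib intro: add_strict_mono)
qed

text \<open>Reading the same number of low digits in all variables leaves a residual relation of the
  high digits. For an atom, the low digits matter only through a bounded carry and through an
  element of the kernel of \<open>X\<close> or the agreement of two remainders. For a quantifier,
  the witness is also split into low and high digits; the residual then depends only on a set of
  residuals of the body, as in the subset construction.\<close>

lemma finite_kernel_sat:
  assumes "finite (kernel b X)" "b > 0"
  shows "finite {\<lambda>e. sat X (\<lambda>v. b ^ j * e v + r v) \<phi> | j r. \<forall>v. r v < b ^ j}"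
proof (induction \<phi>)
  case (Eq s t)
  obtain m m' where m: "\<And>B r. (\<forall>v. r v < B) \<Longrightarrow> val_trm r s < m * B"
    "\<And>B r. (\<forall>v. r v < B) \<Longrightarrow> val_trm r t < m' * B"
    using val_trm_bound by meson
  let ?f = "\<lambda>(g, c, d) e. g \<and> val_trm e s + c = val_trm e t + d"
  have "{\<lambda>e. sat X (\<lambda>v. b ^ j * e v + r v) (Eq s t) | j r. \<forall>v. r v < b ^ j}
      \<subseteq> ?f ` (UNIV \<times> {..<m} \<times> {..<m'})"
  proof safe
    fix j :: nat and r :: "nat \<Rightarrow> nat"
    assume r: "\<forall>v. r v < b ^ j"
    define B where "B = b ^ j"
    have B: "B > 0" using assms(2) by (simp add: B_def)
    define c d where "c = val_trm r s" and "d = val_trm r t"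
    have "B * x + c = B * y + d \<longleftrightarrow> c mod B = d mod B \<and> x + c div B = y + d div B" for x y
    proof
      assume *: "B * x + c = B * y + d"
      then have "(B * x + c) mod B = (B * y + d) mod B" "(B * x + c) div B = (B * y + d) div B"
        by simp_all
      then show "c mod B = d mod B \<and> x + c div B = y + d div B"
        using B by (simp add: div_mult_self4)
    next
      assume *: "c mod B = d mod B \<and> x + c div B = y + d div B"
      have "B * x + c = B * (x + c div B) + c mod B" "B * y + d = B * (y + d div B) + d mod B"
        by (simp_all add: algebra_simps)
      then show "B * x + c = B * y + d" using * by simp
    qed
    then have "(\<lambda>e. sat X (\<lambda>v. b ^ j * e v + r v) (Eq s t))
        = ?f (c mod B = d mod B, c div B, d div B)"
      by (simp add: val_trm_affine c_def d_def B_def)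
    moreover have "c div B < m" "d div B < m'"
      using m[of r B] r B by (auto simp: c_def d_def B_def less_mult_imp_div_less)
    ultimately show "(\<lambda>e. sat X (\<lambda>v. b ^ j * e v + r v) (Eq s t))
        \<in> ?f ` (UNIV \<times> {..<m} \<times> {..<m'})"
      by blast
  qed
  then show ?case by (rule finite_subset) auto
next
  case (Pred t)
  obtain m where m: "\<And>B r. (\<forall>v. r v < B) \<Longrightarrow> val_trm r t < m * B"
    using val_trm_bound by meson
  let ?f = "\<lambda>(h, c) e. h (val_trm e t + c)"
  have "{\<lambda>e. sat X (\<lambda>v. b ^ j * e v + r v) (Pred t) | j r. \<forall>v. r v < b ^ j}
      \<subseteq> ?f ` (kernel b X \<times> {..<m})"
  proof safe
    fix j :: nat and r :: "nat \<Rightarrow> nat"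
    assume r: "\<forall>v. r v < b ^ j"
    define B where "B = b ^ j"
    have B: "B > 0" using assms(2) by (simp add: B_def)
    define c where "c = val_trm r t"
    have "B * x + c = B * (x + c div B) + c mod B" for x
      by (simp add: algebra_simps)
    then have "(\<lambda>e. sat X (\<lambda>v. b ^ j * e v + r v) (Pred t))
        = ?f (\<lambda>a. b ^ j * a + c mod B \<in> X, c div B)"
      by (simp add: val_trm_affine c_def B_def)
    moreover have "c div B < m"
      using m[of r B] r B by (auto simp: c_def B_def less_mult_imp_div_less)
    moreover have "(\<lambda>a. b ^ j * a + c mod B \<in> X) \<in> kernel b X"
      using mod_less_divisor[OF B] unfolding kernel_def B_def by blast
    ultimately show "(\<lambda>e. sat X (\<lambda>v. b ^ j * e v + r v) (Pred t)) \<in> ?f ` (kernel b X \<times> {..<m})"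
      by blast
  qed
  then show ?case by (rule finite_subset) (use assms(1) in auto)
next
  case (Neg \<phi>)
  have "{\<lambda>e. sat X (\<lambda>v. b ^ j * e v + r v) (Neg \<phi>) | j r. \<forall>v. r v < b ^ j}
      \<subseteq> (\<lambda>f e. \<not> f e) ` {\<lambda>e. sat X (\<lambda>v. b ^ j * e v + r v) \<phi> | j r. \<forall>v. r v < b ^ j}"
    (is "_ \<subseteq> _ ` ?C")
  proof safe
    fix j :: nat and r :: "nat \<Rightarrow> nat"
    assume "\<forall>v. r v < b ^ j"
    then have "(\<lambda>e. sat X (\<lambda>v. b ^ j * e v + r v) \<phi>) \<in> ?C" by blast
    then show "(\<lambda>e. sat X (\<lambda>v. b ^ j * e v + r v) (Neg \<phi>)) \<in> (\<lambda>f e. \<not> f e) ` ?C"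
      by (rule rev_image_eqI) simp
  qed
  then show ?case by (rule finite_subset) (use Neg in auto)
next
  case (Conj \<phi> \<psi>)
  have "{\<lambda>e. sat X (\<lambda>v. b ^ j * e v + r v) (Conj \<phi> \<psi>) | j r. \<forall>v. r v < b ^ j}
      \<subseteq> (\<lambda>(f, g) e. f e \<and> g e) ` ({\<lambda>e. sat X (\<lambda>v. b ^ j * e v + r v) \<phi> | j r. \<forall>v. r v < b ^ j}
          \<times> {\<lambda>e. sat X (\<lambda>v. b ^ j * e v + r v) \<psi> | j r. \<forall>v. r v < b ^ j})"
    by (auto simp: image_iff) blast
  then show ?case by (rule finite_subset) (use Conj in auto)
next
  case (Exi x \<phi>)
  let ?C = "{\<lambda>e. sat X (\<lambda>v. b ^ j * e v + r v) \<phi> | j r. \<forall>v. r v < b ^ j}"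
  let ?f = "\<lambda>S e. \<exists>n. \<exists>h\<in>S. h (e(x := n))"
  have "{\<lambda>e. sat X (\<lambda>v. b ^ j * e v + r v) (Exi x \<phi>) | j r. \<forall>v. r v < b ^ j} \<subseteq> ?f ` Pow ?C"
  proof safe
    fix j :: nat and r :: "nat \<Rightarrow> nat"
    assume r: "\<forall>v. r v < b ^ j"
    define S where "S = (\<lambda>\<rho> e. sat X (\<lambda>v. b ^ j * e v + (r(x := \<rho>)) v) \<phi>) ` {..<b ^ j}"
    have S: "S \<subseteq> ?C"
      unfolding S_def
    proof safe
      fix \<rho>
      assume "\<rho> < b ^ j"
      then have "\<forall>v. (r(x := \<rho>)) v < b ^ j" using r by simp
      then show "\<exists>i r'. (\<lambda>e. sat X (\<lambda>v. b ^ j * e v + (r(x := \<rho>)) v) \<phi>)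
          = (\<lambda>e. sat X (\<lambda>v. b ^ i * e v + r' v) \<phi>) \<and> (\<forall>v. r' v < b ^ i)"
        by (intro exI[of _ j] exI[of _ "r(x := \<rho>)"] conjI refl)
    qed
    have "sat X (\<lambda>v. b ^ j * e v + r v) (Exi x \<phi>) \<longleftrightarrow> ?f S e" for e
    proof -
      have upd: "(\<lambda>v. b ^ j * e v + r v)(x := b ^ j * n + \<rho>)
          = (\<lambda>v. b ^ j * (e(x := n)) v + (r(x := \<rho>)) v)" for n \<rho>
        by auto
      have "sat X (\<lambda>v. b ^ j * e v + r v) (Exi x \<phi>)
          \<longleftrightarrow> (\<exists>n \<rho>. \<rho> < b ^ j \<and> sat X ((\<lambda>v. b ^ j * e v + r v)(x := b ^ j * n + \<rho>)) \<phi>)"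
        (is "?l \<longleftrightarrow> ?r")
      proof
        assume ?l
        then obtain m where "sat X ((\<lambda>v. b ^ j * e v + r v)(x := m)) \<phi>" by auto
        moreover have "m mod b ^ j < b ^ j" using assms(2) by simp
        ultimately show ?r
          by (intro exI[of _ "m div b ^ j"] exI[of _ "m mod b ^ j"] conjI) (simp_all only: mult_div_mod_eq)
      next
        assume ?r
        then obtain n \<rho> where "sat X ((\<lambda>v. b ^ j * e v + r v)(x := b ^ j * n + \<rho>)) \<phi>"
          by (elim exE conjE)
        then show ?l unfolding sat.simps by (rule exI)
      qed
      also have "\<dots> \<longleftrightarrow> ?f S e"
        unfolding upd S_def bex_simps by (simp only: Bex_def lessThan_iff)
      finally show ?thesis .
    qed
    then show "(\<lambda>e. sat X (\<lambda>v. b ^ j * e v + r v) (Exi x \<phi>)) \<in> ?f ` Pow ?C"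
      by (intro image_eqI[of _ _ S] ext PowI S)
  qed
  then show ?case by (rule finite_subset) (use Exi in auto)
qed

lemma finite_kernel_rel:
  assumes "finite (kernel b X)" "b > 0" "definable_rel X (\<lambda>e. R (e 0) (e 1))"
  shows "finite {\<lambda>x y. R (b ^ j * x + r) (b ^ j * y + r') | j r r'. r < b ^ j \<and> r' < b ^ j}"
proof -
  obtain \<phi> where \<phi>: "\<And>e. sat X e \<phi> \<longleftrightarrow> R (e 0) (e 1)"
    using assms(3) unfolding definable_rel_def by blast
  have "{\<lambda>x y. R (b ^ j * x + r) (b ^ j * y + r') | j r r'. r < b ^ j \<and> r' < b ^ j}
     \<subseteq> (\<lambda>f x y. f (case_nat x (\<lambda>_. y)))
        ` {\<lambda>e. sat X (\<lambda>v. b ^ j * e v + r v) \<phi> | j r. \<forall>v. r v < b ^ j}"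
  proof safe
    fix j r r'
    assume "r < b ^ j" "r' < b ^ j"
    then have "\<forall>v. (case_nat r (\<lambda>_. r')) v < b ^ j"
      by (auto split: nat.split)
    then have "(\<lambda>e. sat X (\<lambda>v. b ^ j * e v + (case_nat r (\<lambda>_. r')) v) \<phi>)
        \<in> {\<lambda>e. sat X (\<lambda>v. b ^ j * e v + r v) \<phi> | j r. \<forall>v. r v < b ^ j}"
      by blast
    then show "(\<lambda>x y. R (b ^ j * x + r) (b ^ j * y + r')) \<in> (\<lambda>f x y. f (case_nat x (\<lambda>_. y)))
        ` {\<lambda>e. sat X (\<lambda>v. b ^ j * e v + r v) \<phi> | j r. \<forall>v. r v < b ^ j}"
      by (rule rev_image_eqI) (simp add: \<phi>)
  qed
  then show ?thesis
    by (rule finite_subset) (intro finite_imageI finite_kernel_sat assms)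
qed

section \<open>Words in base \<open>k\<close> and kernels of automatic sets\<close>

lemma word_val_Nil [simp]: "word_val k [] = 0"
  by (simp add: word_val_def)

lemma word_val_snoc [simp]: "word_val k (w @ [c]) = k * word_val k w + c"
  by (simp add: word_val_def sum.lessThan_Suc_shift sum_distrib_left mult.left_commute del: sum.lessThan_Suc)

lemma word_val_append: "word_val k (u @ w) = word_val k w + k ^ length w * word_val k u"
proof (induction w rule: rev_induct)
  case (snoc c w)
  then show ?case
    by (simp flip: append_assoc add: algebra_simps)
qed simp

lemma word_val_less:
  assumes "w \<in> lists {..<k}"
  shows "word_val k w < k ^ length w"
  using assms
proof (induction w rule: rev_induct)
  case (snoc c w)
  then have "word_val k w + 1 \<le> k ^ length w" "c < k" by auto
  then have "k * (word_val k w + 1) \<le> k * k ^ length w" by (intro mult_left_mono) auto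
  with \<open>c < k\<close> show ?case by simp
qed simp

lemma word_exists:
  assumes "r < k ^ n"
  shows "\<exists>w\<in>lists {..<k}. length w = n \<and> word_val k w = r"
  using assms
proof (induction n arbitrary: r)
  case (Suc n)
  have "k > 0" using Suc.prems by (cases k) auto
  have "r div k < k ^ n"
    using Suc.prems by (simp add: less_mult_imp_div_less mult.commute)
  then obtain w where "w \<in> lists {..<k}" "length w = n" "word_val k w = r div k"
    using Suc.IH by blast
  then show ?case
    using \<open>k > 0\<close> by (intro bexI[of _ "w @ [r mod k]"]) auto
qed auto

lemma word_unique:
  assumes "w \<in> lists {..<k}" "w' \<in> lists {..<k}" "length w = length w'" "word_val k w = word_val k w'"
  shows "w = w'"
  using assms
proof (induction w arbitrary: w' rule: rev_induct)
  case (snoc c w)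
  then obtain c' v where w': "w' = v @ [c']"
    by (cases w' rule: rev_cases) auto
  have "(k * word_val k w + c) mod k = (k * word_val k v + c') mod k"
       "(k * word_val k w + c) div k = (k * word_val k v + c') div k"
    using snoc.prems(4) by (simp_all add: w')
  moreover have "c < k" "c' < k" "w \<in> lists {..<k}" "v \<in> lists {..<k}" "length w = length v"
    using snoc.prems by (auto simp: w')
  ultimately have "c = c'" "word_val k w = word_val k v"
    by auto
  then show ?case
    using snoc.IH[of v] \<open>w \<in> lists {..<k}\<close> \<open>v \<in> lists {..<k}\<close> \<open>length w = length v\<close> w' by simp
qed simp

text \<open>The low digits \<open>v\<close> act on the states reached by the high digits, and matter
  only through the set \<open>G\<close> of states from which they lead to acceptance.\<close>

lemma finite_kernel_if_k_automatic:
  assumes "k \<ge> 2" "k_automatic k X"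
  shows "finite (kernel k X)"
proof -
  obtain Q :: "nat set" and q0 \<delta> F where Q: "finite Q" "q0 \<in> Q" "\<forall>q\<in>Q. \<forall>a<k. \<delta> q a \<in> Q"
    and X: "X = word_val k ` {w \<in> lists {..<k}. foldl \<delta> q0 w \<in> F}"
    using assms(2) unfolding k_automatic_def regular_lang_def by blast
  define S where "S a = {foldl \<delta> q0 w | w. w \<in> lists {..<k} \<and> word_val k w = a}" for a
  have run: "foldl \<delta> q w \<in> Q" if "q \<in> Q" "w \<in> lists {..<k}" for q w
    using that Q(3) by (induction w arbitrary: q) auto
  \<comment> \<open>The value at \<open>0\<close> is stored separately: \<open>L\<close> need not be
    closed under leading zeros, so \<open>r\<close> may be represented only by words shorter than
    \<open>j\<close>.\<close>
  let ?f = "\<lambda>(g, G) a. if a = 0 then g else S a \<inter> G \<noteq> {}"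
  have "kernel k X \<subseteq> ?f ` (UNIV \<times> Pow Q)"
    unfolding kernel_def
  proof safe
    fix j r
    assume r: "r < k ^ j"
    then obtain v where v: "v \<in> lists {..<k}" "length v = j" "word_val k v = r"
      using word_exists by blast
    define G where "G = {q \<in> Q. foldl \<delta> q v \<in> F}"
    have "k ^ j * a + r \<in> X \<longleftrightarrow> S a \<inter> G \<noteq> {}" if "a > 0" for a
    proof
      assume "k ^ j * a + r \<in> X"
      then obtain w where w: "w \<in> lists {..<k}" "foldl \<delta> q0 w \<in> F" "k ^ j * a + r = word_val k w"
        unfolding X by (elim imageE CollectE conjE)
      have "k ^ j \<le> k ^ j * a" using that by (cases a) simp_all
      also have "\<dots> \<le> word_val k w" using w(3) by simp
      also have "\<dots> < k ^ length w" using word_val_less[OF w(1)] .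
      finally have "j \<le> length w"
        using assms(1) by (simp add: power_less_imp_less_exp less_imp_le)
      define w1 w2 where "w1 = take (length w - j) w" and "w2 = drop (length w - j) w"
      have w12: "w = w1 @ w2" "length w2 = j" "w1 \<in> lists {..<k}" "w2 \<in> lists {..<k}"
        using \<open>j \<le> length w\<close> w(1) by (auto simp: w1_def w2_def dest: in_set_takeD in_set_dropD)
      have eq: "word_val k w2 + k ^ j * word_val k w1 = r + k ^ j * a"
        using w(3) w12 by (simp add: word_val_append)
      have "word_val k w2 < k ^ j" using word_val_less[OF w12(4)] w12(2) by simp
      then have "word_val k w2 = r" "word_val k w1 = a"
        using arg_cong[OF eq, of "\<lambda>x. x mod k ^ j"] arg_cong[OF eq, of "\<lambda>x. x div k ^ j"] r
          assms(1) by auto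
      moreover from this have "w2 = v"
        by (intro word_unique[OF w12(4) v(1)]) (use w12 v in auto)
      ultimately have "foldl \<delta> q0 w1 \<in> S a \<inter> G"
        using w w12 run[OF Q(2) w12(3)] by (auto simp: S_def G_def)
      then show "S a \<inter> G \<noteq> {}" by blast
    next
      assume "S a \<inter> G \<noteq> {}"
      then obtain w where w: "w \<in> lists {..<k}" "word_val k w = a" "foldl \<delta> (foldl \<delta> q0 w) v \<in> F"
        by (auto simp: S_def G_def)
      then have "word_val k (w @ v) = k ^ j * a + r" "foldl \<delta> q0 (w @ v) \<in> F" "w @ v \<in> lists {..<k}"
        using v by (auto simp: word_val_append)
      then show "k ^ j * a + r \<in> X"
        unfolding X by (intro image_eqI[of _ _ "w @ v"] CollectI conjI) (simp_all only:)
    qed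
    then have "(\<lambda>a. k ^ j * a + r \<in> X) = ?f (r \<in> X, G)"
      by (intro ext) simp
    moreover have "G \<in> Pow Q" by (auto simp: G_def)
    ultimately show "(\<lambda>a. k ^ j * a + r \<in> X) \<in> ?f ` (UNIV \<times> Pow Q)"
      by blast
  qed
  then show ?thesis by (rule finite_subset) (use Q(1) in auto)
qed

section \<open>Codings by blocks\<close>

lemma all_less_mult: "(\<forall>c<m * n. P c) \<longleftrightarrow> (\<forall>d<m. \<forall>c<n. P (n * d + c))" for m n :: nat
proof safe
  fix d c
  assume P: "\<forall>c<m * n. P c" and "d < m" "c < n"
  have "n * d + c < n * Suc d" using \<open>c < n\<close> by simp
  also have "\<dots> \<le> n * m" using \<open>d < m\<close> by (intro mult_le_mono2) simp
  finally show "P (n * d + c)" using P by (simp add: mult.commute)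
next
  fix c
  assume *: "\<forall>d<m. \<forall>c<n. P (n * d + c)" and c: "c < m * n"
  then have "n > 0" by (cases n) auto
  then have "c div n < m" "c mod n < n" using c by (auto simp: less_mult_imp_div_less)
  then have "P (n * (c div n) + c mod n)" using * by blast
  then show "P c" by simp
qed

lemma digits_less:
  assumes "i < K ^ n" "j < K ^ m"
  shows "K ^ m * i + j < (K :: nat) ^ (n + m)"
proof -
  have "K ^ m * i + j < K ^ m * Suc i" using assms(2) by simp
  also have "\<dots> \<le> K ^ m * K ^ n" using assms(1) by (intro mult_le_mono2) simp
  finally show ?thesis by (simp add: power_add mult.commute)
qed

text \<open>The sequence is eventually periodic, with preperiod \<open>i\<close> and period
  \<open>p\<close>; \<open>d\<close> is a multiple of \<open>p\<close> that is at least
  \<open>i\<close>.\<close>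

lemma iterates_idempotent:
  fixes u :: "nat \<Rightarrow> 'a"
  assumes "finite (range u)" "\<And>n. u (Suc n) = F (u n)"
  shows "\<exists>d\<ge>1. \<forall>t\<ge>1. u (t * d) = u d"
proof -
  have "\<not> inj u" using assms(1) finite_imageD infinite_UNIV_nat by blast
  then obtain i j where ij: "i < j" "u i = u j"
    by (metis injI linorder_neqE_nat)
  define p where "p = j - i"
  have p: "u (n + p) = u n" if "n \<ge> i" for n
    using that
  proof (induction n rule: dec_induct)
    case base
    then show ?case using ij by (simp add: p_def)
  next
    case (step n)
    then show ?case by (simp add: assms(2))
  qed
  have mp: "u (n + m * p) = u n" if "n \<ge> i" for n m
  proof (induction m)
    case (Suc m)
    have "u (n + Suc m * p) = u (n + m * p + p)" by (simp add: algebra_simps)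
    also have "\<dots> = u n" using p[of "n + m * p"] that Suc by simp
    finally show ?case .
  qed simp
  define d where "d = Suc i * p"
  have "p \<ge> 1" using ij by (simp add: p_def)
  then have "d \<ge> Suc i * 1" unfolding d_def by (intro mult_le_mono2)
  then have d: "d \<ge> 1" "d \<ge> i" by simp_all
  have "u (t * d) = u d" if "t \<ge> 1" for t
  proof -
    obtain t' where t: "t = Suc t'" using \<open>t \<ge> 1\<close> not0_implies_Suc[of t] by auto
    have "t * d = d + (t' * Suc i) * p" by (simp only: t d_def mult_Suc mult.assoc)
    then show ?thesis using mp[OF d(2)] by simp
  qed
  then show ?thesis using d by blast
qed

text \<open>From left to right, \<open>block_eq\<close> says that \<open>s\<close> is fixed by a
  \<open>K\<close>-uniform substitution; from right to left, that this substitution is injective on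
  letters.\<close>

locale block_coding =
  fixes s :: "nat \<Rightarrow> 'q" and K :: nat
  assumes base: "K \<ge> 2"
    and finite_range: "finite (range s)"
    and block_eq: "s a = s b \<longleftrightarrow> (\<forall>c<K. s (K * a + c) = s (K * b + c))"

text \<open>The relation \<open>u n\<close> compares numbers by their blocks of length
  \<open>k ^ n\<close>. A block depends only on the set \<open>\<pi> a\<close> of kernel elements
  that hold at \<open>a\<close>, so there are finitely many such relations, and each determines the
  next. For an idempotent exponent \<open>d\<close>, the equation \<open>u (2 * d) = u d\<close> is
  the required equivalence.\<close>

lemma ex_block_coding:
  assumes "k \<ge> 2" "finite (kernel k X)"
  shows "\<exists>d\<ge>1. block_coding (\<lambda>a. {c. c < k ^ d \<and> k ^ d * a + c \<in> X}) (k ^ d)"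
proof -
  define bl where "bl n a = {r. r < k ^ n \<and> k ^ n * a + r \<in> X}" for n a
  define u where "u n = {(a, b). bl n a = bl n b}" for n
  define \<pi> where "\<pi> a = {h \<in> kernel k X. h a}" for a :: nat
  have bl_iff: "bl (m + n) a = bl (m + n) b \<longleftrightarrow> (\<forall>c<k ^ m. bl n (k ^ m * a + c) = bl n (k ^ m * b + c))"
    for m n a b
  proof -
    have eq: "bl n a = bl n b \<longleftrightarrow> (\<forall>r<k ^ n. k ^ n * a + r \<in> X \<longleftrightarrow> k ^ n * b + r \<in> X)" for n a b
      by (auto simp: bl_def set_eq_iff)
    show ?thesis
      unfolding eq power_add all_less_mult by (simp add: algebra_simps)
  qed
  have "bl n a = (\<lambda>P. {r. r < k ^ n \<and> (\<lambda>a. k ^ n * a + r \<in> X) \<in> P}) (\<pi> a)" for n a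
    unfolding bl_def \<pi>_def kernel_def by blast
  then have u_eq: "u n = (\<lambda>R. {(a, b). (\<pi> a, \<pi> b) \<in> R})
      {(P, P'). P \<subseteq> kernel k X \<and> P' \<subseteq> kernel k X
        \<and> {r. r < k ^ n \<and> (\<lambda>a. k ^ n * a + r \<in> X) \<in> P} = {r. r < k ^ n \<and> (\<lambda>a. k ^ n * a + r \<in> X) \<in> P'}}"
    for n
    unfolding u_def by (auto simp: \<pi>_def)
  have "range u \<subseteq> (\<lambda>R. {(a, b). (\<pi> a, \<pi> b) \<in> R}) ` Pow (Pow (kernel k X) \<times> Pow (kernel k X))"
    unfolding u_eq by (intro image_subsetI imageI) auto
  then have "finite (range u)"
    by (rule finite_subset) (use assms(2) in auto)
  moreover define F where "F R = {(a, b). \<forall>c<k. (k * a + c, k * b + c) \<in> R}" for R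
  have "u (Suc n) = F (u n)" for n
    using bl_iff[of 1 n] by (simp add: u_def F_def)
  ultimately obtain d where d: "d \<ge> 1" "\<And>t. t \<ge> 1 \<Longrightarrow> u (t * d) = u d"
    using iterates_idempotent[of u F] by blast
  have "block_coding (bl d) (k ^ d)"
  proof
    have "2 ^ 1 \<le> k ^ d"
      using assms(1) d(1) by (metis le_trans one_le_numeral power_increasing power_mono zero_le)
    then show "2 \<le> k ^ d" by simp
    have "range (bl d) \<subseteq> Pow {..<k ^ d}" by (auto simp: bl_def)
    then show "finite (range (bl d))" by (rule finite_subset) simp
    show "bl d a = bl d b \<longleftrightarrow> (\<forall>c<k ^ d. bl d (k ^ d * a + c) = bl d (k ^ d * b + c))" for a b
    proof -
      have "(a, b) \<in> u (2 * d) \<longleftrightarrow> (a, b) \<in> u d" using d(2)[of 2] by simp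
      then have "bl d a = bl d b \<longleftrightarrow> bl (d + d) a = bl (d + d) b"
        by (simp add: u_def mult_2)
      then show ?thesis unfolding bl_iff .
    qed
  qed
  then show ?thesis using d(1) unfolding bl_def by blast
qed

text \<open>Letter \<open>i\<close> of the \<open>n\<close>-th iterated image of \<open>q\<close>
  under the substitution, read off at an arbitrary occurrence of \<open>q\<close>. By
  \<open>level_eq\<close> the choice is immaterial for \<open>i < K ^ n\<close>.\<close>

definition blk :: "(nat \<Rightarrow> 'q) \<Rightarrow> nat \<Rightarrow> nat \<Rightarrow> 'q \<Rightarrow> nat \<Rightarrow> 'q" where
  "blk s K n q i = s (K ^ n * (SOME a. s a = q) + i)"

lemma blk_power: "blk s (K ^ m) n q i = blk s K (m * n) q i"
  by (simp add: blk_def power_mult)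

lemma blk_in_range: "blk s K n q i \<in> range s"
  by (simp add: blk_def)

section \<open>Composition and return of iterated images\<close>

context block_coding
begin

lemma level_eq: "s a = s b \<longleftrightarrow> (\<forall>c<K ^ n. s (K ^ n * a + c) = s (K ^ n * b + c))"
proof (induction n arbitrary: a b)
  case (Suc n)
  have "s a = s b \<longleftrightarrow> (\<forall>d<K. \<forall>c<K ^ n. s (K ^ n * (K * a + d) + c) = s (K ^ n * (K * b + d) + c))"
    unfolding block_eq[of a b] using Suc by blast
  also have "\<dots> \<longleftrightarrow> (\<forall>c<K * K ^ n. s (K ^ Suc n * a + c) = s (K ^ Suc n * b + c))"
    unfolding all_less_mult by (simp add: algebra_simps)
  finally show ?case by simp
qed simp

lemma power_pos: "K ^ n > 0"
  using base by simp

lemma block_coding_power: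
  assumes "n \<ge> 1"
  shows "block_coding s (K ^ n)"
proof
  have "K ^ 1 \<le> K ^ n" using assms base by (intro power_increasing) auto
  then show "2 \<le> K ^ n" using base by simp
qed (use finite_range level_eq in auto)

lemma rep: "q \<in> range s \<Longrightarrow> s (SOME a. s a = q) = q"
  by (rule someI_ex) auto

lemma blk: "i < K ^ n \<Longrightarrow> s (K ^ n * a + i) = blk s K n (s a) i"
  unfolding blk_def using level_eq[of "SOME b. s b = s a" a n] rep[of "s a"] by simp

lemma blk_0: "q \<in> range s \<Longrightarrow> blk s K 0 q 0 = q"
  by (simp add: blk_def rep)

lemma blk_add:
  assumes "i < K ^ n" "j < K ^ m" "q \<in> range s"
  shows "blk s K (n + m) q (K ^ m * i + j) = blk s K m (blk s K n q i) j"
proof -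
  define a where "a = (SOME a. s a = q)"
  have "s (K ^ (n + m) * a + (K ^ m * i + j)) = s (K ^ m * (K ^ n * a + i) + j)"
    by (simp add: algebra_simps power_add)
  also have "\<dots> = blk s K m (blk s K n (s a) i) j"
    using assms by (simp add: blk)
  finally show ?thesis
    using rep[OF assms(3)] by (simp add: blk_def a_def)
qed

lemma blk_inj:
  assumes "q \<in> range s" "q' \<in> range s" "\<And>i. i < K ^ n \<Longrightarrow> blk s K n q i = blk s K n q' i"
  shows "q = q'"
  using level_eq[of "SOME a. s a = q" "SOME a. s a = q'" n] assms rep
  by (simp add: blk_def)

lemma return_mult:
  assumes "q \<in> range s" "c < K ^ l" "blk s K l q c = q"
  shows "\<exists>c<K ^ (t * l). blk s K (t * l) q c = q"
proof (induction t)
  case 0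
  then show ?case using blk_0[OF assms(1)] by auto
next
  case (Suc t)
  then obtain c' where c': "c' < K ^ (t * l)" "blk s K (t * l) q c' = q" by blast
  have "blk s K (l + t * l) q (K ^ (t * l) * c + c') = q"
    using blk_add[OF assms(2) c'(1) assms(1)] assms(3) c'(2) by simp
  moreover have "K ^ (t * l) * c + c' < K ^ (l + t * l)"
    by (rule digits_less[OF assms(2) c'(1)])
  ultimately show ?case by auto
qed

text \<open>By \<open>return_mult\<close>, multiples of a return length are return lengths, so a
  common multiple \<open>D\<close> of one return length per letter serves all letters. The factor
  \<open>d1\<close> is an idempotent exponent of the map from a letter to the first letter of its
  image.\<close>

lemma ex_normalized_power:
  "\<exists>d\<ge>1. (\<forall>q\<in>range s. (\<exists>n\<ge>1. \<exists>c<(K ^ d) ^ n. blk s (K ^ d) n q c = q) \<longrightarrow> (\<exists>c<K ^ d. blk s (K ^ d) 1 q c = q))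
     \<and> (\<forall>q\<in>range s. blk s (K ^ d) 1 (blk s (K ^ d) 1 q 0) 0 = blk s (K ^ d) 1 q 0)"
proof -
  define u where "u n = (\<lambda>q. (q, blk s K n q 0)) ` range s" for n
  have "range u \<subseteq> Pow (range s \<times> range s)"
    by (auto simp: u_def blk_def)
  then have "finite (range u)"
    by (rule finite_subset) (use finite_range in auto)
  moreover define F where "F = image (\<lambda>(q :: 'q, p). (q, blk s K 1 p 0))"
  have "u (Suc n) = F (u n)" for n
  proof -
    have "blk s K (Suc n) q 0 = blk s K 1 (blk s K n q 0) 0" if "q \<in> range s" for q
      using blk_add[of 0 n 0 1 q] power_pos[of n] base that by simp
    then show ?thesis
      unfolding u_def F_def image_image[of _ "\<lambda>q. (q, blk s K n q 0)"] by (intro image_cong) simp_all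
  qed
  ultimately obtain d1 where d1: "d1 \<ge> 1" "\<And>t. t \<ge> 1 \<Longrightarrow> u (t * d1) = u d1"
    using iterates_idempotent[of u F] by blast
  have first: "blk s K (t * d1) q 0 = blk s K d1 q 0" if "q \<in> range s" "t \<ge> 1" for t q
  proof -
    have "(q, blk s K (t * d1) q 0) \<in> u (t * d1)" unfolding u_def using that by blast
    then have "(q, blk s K (t * d1) q 0) \<in> u d1" using d1 that by simp
    then show ?thesis unfolding u_def by auto
  qed
  define ret where "ret q l \<longleftrightarrow> l \<ge> 1 \<and> (\<exists>c<K ^ l. blk s K l q c = q)" for q l
  \<comment> \<open>The default \<open>1\<close> is neutral in the product \<open>D\<close>.\<close>
  define len where "len q = (if \<exists>l. ret q l then SOME l. ret q l else 1)" for q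
  have len: "ret q (len q)" if "\<exists>l. ret q l" for q
    using that unfolding len_def by (simp add: someI_ex)
  have len_pos: "len q \<ge> 1" for q
    using len[of q] by (cases "\<exists>l. ret q l") (auto simp: ret_def len_def)
  define D where "D = prod len (range s)"
  have D: "D \<ge> 1" unfolding D_def using len_pos by (metis le_numeral_extra(4) prod_ge_1)
  define d where "d = D * d1"
  have d: "d \<ge> 1" using D d1(1) by (simp add: d_def)
  show ?thesis
  proof (rule exI[of _ d], intro conjI ballI impI)
    fix q
    assume q: "q \<in> range s" and "\<exists>n\<ge>1. \<exists>c<(K ^ d) ^ n. blk s (K ^ d) n q c = q"
    then obtain n c where "n \<ge> 1" "c < K ^ (d * n)" "blk s K (d * n) q c = q"
      by (auto simp: blk_power power_mult)
    then have "ret q (d * n)" using d by (auto simp: ret_def)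
    then have "ret q (len q)" using len by blast
    then obtain c where c: "c < K ^ len q" "blk s K (len q) q c = q" by (auto simp: ret_def)
    have "len q dvd D" unfolding D_def using finite_range q by (intro dvd_prodI)
    then obtain t where "d = t * len q" by (metis d_def dvd_def mult.assoc mult.commute)
    then show "\<exists>c<K ^ d. blk s (K ^ d) 1 q c = q"
      using return_mult[OF q c] by (simp add: blk_power)
  next
    fix q
    assume q: "q \<in> range s"
    have "blk s K (d + d) q (K ^ d * 0 + 0) = blk s K d (blk s K d q 0) 0"
      by (rule blk_add) (use q power_pos in auto)
    moreover have "blk s K (d + d) q 0 = blk s K d q 0"
      using first[OF q, of "D + D"] first[OF q, of D] D by (simp add: d_def add_mult_distrib)
    ultimately show "blk s (K ^ d) 1 (blk s (K ^ d) 1 q 0) 0 = blk s (K ^ d) 1 q 0"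
      by (simp add: blk_power)
  qed (rule d)
qed

end

section \<open>Sparse aperiodic blocks\<close>

text \<open>One period must serve all levels \<open>n\<close>; images of length at most
  \<open>p\<close> meet the condition vacuously.\<close>

definition uniformly_periodic :: "(nat \<Rightarrow> 'q) \<Rightarrow> nat \<Rightarrow> 'q \<Rightarrow> bool" where
  "uniformly_periodic s K q \<longleftrightarrow> (\<exists>p\<ge>1. \<forall>n i. i + p < K ^ n \<longrightarrow> blk s K n q (i + p) = blk s K n q i)"

text \<open>The level is given by the power \<open>z\<close>, since formulas have access to powers
  of \<open>K\<close> but not to exponents.\<close>

definition block_rel :: "(nat \<Rightarrow> 'q) \<Rightarrow> nat \<Rightarrow> 'q \<Rightarrow> 'q \<Rightarrow> nat \<Rightarrow> nat \<Rightarrow> bool" where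
  "block_rel s K q p z r \<longleftrightarrow> (\<exists>n. z = K ^ n \<and> r < z \<and> blk s K n q r = p)"

lemma periodic_mod:
  fixes p :: nat
  assumes "\<And>i. i + p < N \<Longrightarrow> f (i + p) = f i" "r < N"
  shows "f r = f (r mod p)"
  using assms(2)
proof (induction r rule: less_induct)
  case (less r)
  show ?case
  proof (cases "r < p \<or> p = 0")
    case False
    then have "f r = f (r - p)" using assms(1)[of "r - p"] less.prems by simp
    also have "\<dots> = f ((r - p) mod p)" using less False by simp
    finally show ?thesis using False by (simp add: le_mod_geq)
  qed auto
qed

context block_coding
begin

definition reach :: "'q \<Rightarrow> 'q set" where
  "reach q = {blk s K n q c | n c. c < K ^ n}"

lemma reach_subset: "reach q \<subseteq> range s"
  by (auto simp: reach_def blk_in_range[simplified])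

lemma reach_refl: "q \<in> range s \<Longrightarrow> q \<in> reach q"
  unfolding reach_def using blk_0[of q] power_pos[of 0] by (metis (mono_tags, lifting) mem_Collect_eq)

text \<open>Reachability is transitive and \<open>q\<close> itself gets lost. This is the measure
  for the induction in \<open>definable_rel_block_rel\<close>.\<close>

lemma card_reach_less:
  assumes "q \<in> range s" "c < K" "q \<notin> reach (blk s K 1 q c)"
  shows "card (reach (blk s K 1 q c)) < card (reach q)"
proof (rule psubset_card_mono)
  show "finite (reach q)" using finite_subset[OF reach_subset finite_range] .
  have "reach (blk s K 1 q c) \<subseteq> reach q"
  proof
    fix p
    assume "p \<in> reach (blk s K 1 q c)"
    then obtain n d where "d < K ^ n" "p = blk s K n (blk s K 1 q c) d"
      by (auto simp: reach_def)
    then have "p = blk s K (1 + n) q (K ^ n * c + d)" "K ^ n * c + d < K ^ (1 + n)"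
      using blk_add[of c 1 d n q] digits_less[of c K 1 d n] assms by auto
    then show "p \<in> reach q" unfolding reach_def by blast
  qed
  then show "reach (blk s K 1 q c) \<subset> reach q"
    using reach_refl assms by blast
qed

lemma blk_first_iterate:
  assumes "q \<in> range s" "blk s K 1 (blk s K 1 q 0) 0 = blk s K 1 q 0" "n \<ge> 1"
  shows "blk s K n q 0 = blk s K 1 q 0"
  using assms(3)
proof (induction n rule: dec_induct)
  case (step n)
  have "blk s K (n + 1) q (K ^ 1 * 0 + 0) = blk s K 1 (blk s K n q 0) 0"
    by (rule blk_add) (use assms base in auto)
  then show ?case using step assms(2) by simp
qed simp

lemma blk_Suc_iff:
  assumes "q \<in> range s"
  shows "r < K ^ Suc n \<and> blk s K (Suc n) q r = p
    \<longleftrightarrow> (\<exists>c<K. \<exists>r'<K ^ n. r = c * K ^ n + r' \<and> blk s K n (blk s K 1 q c) r' = p)"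
proof
  assume r: "r < K ^ Suc n \<and> blk s K (Suc n) q r = p"
  have "r div K ^ n < K" "r mod K ^ n < K ^ n"
    using r base by (auto simp: less_mult_imp_div_less)
  moreover have "r = r div K ^ n * K ^ n + r mod K ^ n" by (rule div_mult_mod_eq[symmetric])
  moreover have "blk s K n (blk s K 1 q (r div K ^ n)) (r mod K ^ n) = p"
    using blk_add[of "r div K ^ n" 1 "r mod K ^ n" n q] assms calculation(1,2) r by simp
  ultimately show "\<exists>c<K. \<exists>r'<K ^ n. r = c * K ^ n + r' \<and> blk s K n (blk s K 1 q c) r' = p"
    by blast
next
  assume "\<exists>c<K. \<exists>r'<K ^ n. r = c * K ^ n + r' \<and> blk s K n (blk s K 1 q c) r' = p"
  then show "r < K ^ Suc n \<and> blk s K (Suc n) q r = p"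
    using blk_add[of _ 1 _ n q] digits_less[of _ K 1 _ n] assms by (auto simp: mult.commute)
qed

text \<open>The digits of \<open>r\<close> are a run of \<open>c0\<close>, with value \<open>c0 * R\<close>, followed either by nothing or by a
  digit \<open>c \<noteq> c0\<close> and the remaining digits \<open>r'\<close>.\<close>

lemma loop_iff:
  assumes q: "q \<in> range s" and c0: "c0 < K" "blk s K 1 q c0 = q"
  shows "r < K ^ n \<and> blk s K n q r = p \<longleftrightarrow>
    (\<exists>R. (K - 1) * R + 1 = K ^ n \<and> r = c0 * R \<and> q = p) \<or>
    (\<exists>c\<in>{..<K} - {c0}. \<exists>m r' R. r' < K ^ m \<and> blk s K m (blk s K 1 q c) r' = p \<and>
        (K - 1) * R + K * K ^ m = K ^ n \<and> r = c0 * R + c * K ^ m + r')"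
    (is "_ \<longleftrightarrow> ?B n r")
proof (induction n arbitrary: r)
  case 0
  have "a + K * K ^ m \<noteq> 1" for a m
    using mult_le_mono[OF base, of 1 "K ^ m"] power_pos[of m] by simp
  then have "?B 0 r \<longleftrightarrow> r = 0 \<and> q = p"
    using base by auto
  then show ?case using blk_0[OF q] by auto
next
  case (Suc n)
  define L where "L = K - 1"
  have L: "L \<ge> 1" "K = Suc L" using base by (auto simp: L_def)
  \<comment> \<open>In both uses \<open>R\<close> is a geometric sum of powers of \<open>K\<close>,
    which the linear equation defines from the power \<open>K ^ Suc n\<close>. Splitting off its
    largest summand \<open>K ^ n\<close> gives the sum for one level less.\<close>
  have run: "\<exists>R1. R = K ^ n + R1 \<and> L * R1 + x = K ^ n"
    if "L * R + x = K ^ Suc n" "x \<le> K ^ n" for R x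
  proof -
    have "L * K ^ n + K ^ n = L * R + x" using that(1) by (simp add: L(2))
    then have "L * K ^ n \<le> L * R" using that(2) by linarith
    then have "K ^ n \<le> R" using L(1) by simp
    then obtain R1 where R1: "R = K ^ n + R1" using le_Suc_ex by blast
    then have "L * R1 + x = K ^ n"
      using that(1) by (simp add: L(2) algebra_simps)
    then show ?thesis using R1 by blast
  qed
  have "?B (Suc n) r \<longleftrightarrow> (\<exists>r1. r = c0 * K ^ n + r1 \<and> ?B n r1) \<or>
     (\<exists>c\<in>{..<K} - {c0}. \<exists>r'<K ^ n. blk s K n (blk s K 1 q c) r' = p \<and> r = c * K ^ n + r')"
     (is "_ \<longleftrightarrow> ?l \<or> ?r")
  proof
    assume "?B (Suc n) r"
    then show "?l \<or> ?r"
    proof (elim disjE exE bexE conjE)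
      fix R
      assume "(K - 1) * R + 1 = K ^ Suc n" and r: "r = c0 * R" and "q = p"
      then obtain R1 where "R = K ^ n + R1" "L * R1 + 1 = K ^ n"
        using run[of R 1] power_pos[of n] by (auto simp: L_def)
      then have "r = c0 * K ^ n + c0 * R1" "(K - 1) * R1 + 1 = K ^ n"
        using r by (simp_all add: algebra_simps L_def)
      then show ?thesis using \<open>q = p\<close> by blast
    next
      fix c m r' R
      assume c: "c \<in> {..<K} - {c0}" and r': "r' < K ^ m" "blk s K m (blk s K 1 q c) r' = p"
        and R: "(K - 1) * R + K * K ^ m = K ^ Suc n" and r: "r = c0 * R + c * K ^ m + r'"
      have "K * K ^ m \<le> K * K ^ n" using R unfolding power_Suc by linarith
      then have "m \<le> n" using base by simp
      then consider "m = n" | "Suc m \<le> n" by linarith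
      then show ?thesis
      proof cases
        case 1
        then have "R = 0" using R base by simp
        then show ?thesis using 1 r r' c by auto
      next
        case 2
        then have "K * K ^ m \<le> K ^ n" using power_increasing[OF 2, of K] base by simp
        then obtain R1 where "R = K ^ n + R1" "L * R1 + K * K ^ m = K ^ n"
          using run[of R "K * K ^ m"] R by (auto simp: L_def)
        then have "r = c0 * K ^ n + (c0 * R1 + c * K ^ m + r')" "(K - 1) * R1 + K * K ^ m = K ^ n"
          using r by (simp_all add: algebra_simps L_def)
        then show ?thesis using c r' by blast
      qed
    qed
  next
    assume "?l \<or> ?r"
    then show "?B (Suc n) r"
    proof (elim disjE exE bexE conjE)
      fix r1 R
      assume "r = c0 * K ^ n + r1" "(K - 1) * R + 1 = K ^ n" "r1 = c0 * R" "q = p"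
      then have "(K - 1) * (K ^ n + R) + 1 = K ^ Suc n \<and> r = c0 * (K ^ n + R) \<and> q = p"
        by (simp add: algebra_simps L)
      then show ?thesis by blast
    next
      fix r1 c m r' R
      assume "r = c0 * K ^ n + r1" "c \<in> {..<K} - {c0}" "r' < K ^ m"
        "blk s K m (blk s K 1 q c) r' = p" "(K - 1) * R + K * K ^ m = K ^ n"
        "r1 = c0 * R + c * K ^ m + r'"
      moreover from this have "(K - 1) * (K ^ n + R) + K * K ^ m = K ^ Suc n"
        "r = c0 * (K ^ n + R) + c * K ^ m + r'"
        by (simp_all add: algebra_simps L)
      ultimately show ?thesis by blast
    next
      fix c r'
      assume "c \<in> {..<K} - {c0}" "r' < K ^ n" "blk s K n (blk s K 1 q c) r' = p" "r = c * K ^ n + r'"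
      moreover from this have "(K - 1) * 0 + K * K ^ n = K ^ Suc n" "r = c0 * 0 + c * K ^ n + r'"
        by simp_all
      ultimately show ?thesis by blast
    qed
  qed
  also have "\<dots> \<longleftrightarrow> (\<exists>c<K. \<exists>r'<K ^ n. r = c * K ^ n + r' \<and> blk s K n (blk s K 1 q c) r' = p)"
    unfolding Suc.IH[symmetric] using c0 by auto
  finally show ?case unfolding blk_Suc_iff[OF q] by simp
qed

text \<open>Induction over the reachability order. For a periodic letter only a residue of the
  position matters. For a letter with a loop \<open>c0\<close>, \<open>loop_iff\<close> applies, and
  by \<open>unique\<close> no other letter of its image leads back to it. A letter without a loop is
  never reached again because of \<open>ret\<close>, and one step of the substitution
  suffices.\<close>

lemma definable_rel_block_rel:
  assumes pw: "\<And>t. definable_fun Z t \<Longrightarrow> definable_rel Z (\<lambda>e. t e \<in> range ((^) K))"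
    and ret: "\<And>q n c. q \<in> range s \<Longrightarrow> n \<ge> 1 \<Longrightarrow> c < K ^ n \<Longrightarrow> blk s K n q c = q
      \<Longrightarrow> \<exists>c<K. blk s K 1 q c = q"
    and idem: "\<And>q. q \<in> range s \<Longrightarrow> blk s K 1 (blk s K 1 q 0) 0 = blk s K 1 q 0"
    and unique: "\<And>q n c c'. q \<in> range s \<Longrightarrow> \<not> uniformly_periodic s K q \<Longrightarrow> c < K ^ n \<Longrightarrow> c' < K ^ n
      \<Longrightarrow> blk s K n q c = q \<Longrightarrow> blk s K n q c' = q \<Longrightarrow> c = c'"
    and "q \<in> range s" "definable_fun Z t" "definable_fun Z u"
  shows "definable_rel Z (\<lambda>e. block_rel s K q p (t e) (u e))"
  using assms(5-7)
proof (induction "card (reach q)" arbitrary: q t u rule: less_induct)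
  case less
  note q = \<open>q \<in> range s\<close>
  note ren = definable_fun_ren[OF \<open>definable_fun Z t\<close>] definable_fun_ren[OF \<open>definable_fun Z u\<close>]
  note tu = \<open>definable_fun Z t\<close> \<open>definable_fun Z u\<close>
  have IH: "definable_rel Z (\<lambda>e. block_rel s K (blk s K 1 q c) p (t' e) (u' e))"
    if "c < K" "q \<notin> reach (blk s K 1 q c)" "definable_fun Z t'" "definable_fun Z u'" for c t' u'
    by (rule less.hyps[OF card_reach_less[OF q that(1,2)] blk_in_range that(3,4)])
  consider (per) "uniformly_periodic s K q"
    | (loop) c0 where "\<not> uniformly_periodic s K q" "c0 < K" "blk s K 1 q c0 = q"
    | (no_loop) "\<nexists>c. c < K \<and> blk s K 1 q c = q"
    by blast
  then show ?case
  proof cases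
    case per
    then obtain p' where p': "p' \<ge> 1" "\<And>n i. i + p' < K ^ n \<Longrightarrow> blk s K n q (i + p') = blk s K n q i"
      unfolding uniformly_periodic_def by blast
    have "p' < K ^ p'" using base by (simp add: power_gt_expt)
    then obtain j where j: "p' < K ^ j" by blast
    define q1 where "q1 = blk s K 1 q 0"
    \<comment> \<open>By \<open>idem\<close>, the \<open>(n - j)\<close>-th image of
      \<open>q\<close> starts with \<open>q1\<close>, so the \<open>n\<close>-th image of
      \<open>q\<close> starts with the \<open>j\<close>-th image of \<open>q1\<close>. As
      \<open>p' < K ^ j\<close>, this prefix covers all residues modulo \<open>p'\<close>.\<close>
    have large: "blk s K n q r = blk s K j q1 (r mod p')" if "r < K ^ n" "j < n" for n r
    proof -
      have "r mod p' < K ^ j" using p'(1) j mod_less_divisor[of p' r] by linarith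
      then have "blk s K ((n - j) + j) q (K ^ j * 0 + r mod p') = blk s K j (blk s K (n - j) q 0) (r mod p')"
        by (intro blk_add) (use q power_pos in auto)
      then have "blk s K n q (r mod p') = blk s K j q1 (r mod p')"
        using that(2) blk_first_iterate[OF q idem[OF q], of "n - j"] by (simp add: q1_def)
      then show ?thesis
        using periodic_mod[of p' "K ^ n" "blk s K n q" r] p'(2) that(1) by simp
    qed
    have "definable_rel Z (\<lambda>e. (\<exists>n\<in>{..j}. \<exists>\<rho>\<in>{\<rho>. \<rho> < K ^ n \<and> blk s K n q \<rho> = p}. t e = K ^ n \<and> u e = \<rho>) \<or>
       (t e \<in> range ((^) K) \<and> K ^ j < t e \<and> u e < t e \<and>
          (\<exists>\<rho>\<in>{\<rho>. \<rho> < p' \<and> blk s K j q1 \<rho> = p}. u e mod p' = \<rho>)))"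
      by (intro definable_intros definable_rel_bex_finite definable_rel_mod pw tu) (use p'(1) in auto)
    moreover have "block_rel s K q p z r \<longleftrightarrow>
       (\<exists>n\<in>{..j}. \<exists>\<rho>\<in>{\<rho>. \<rho> < K ^ n \<and> blk s K n q \<rho> = p}. z = K ^ n \<and> r = \<rho>) \<or>
       (z \<in> range ((^) K) \<and> K ^ j < z \<and> r < z \<and>
          (\<exists>\<rho>\<in>{\<rho>. \<rho> < p' \<and> blk s K j q1 \<rho> = p}. r mod p' = \<rho>))" for z r
    proof
      assume "block_rel s K q p z r"
      then obtain n where n: "z = K ^ n" "r < z" "blk s K n q r = p" by (auto simp: block_rel_def)
      show "(\<exists>n\<in>{..j}. \<exists>\<rho>\<in>{\<rho>. \<rho> < K ^ n \<and> blk s K n q \<rho> = p}. z = K ^ n \<and> r = \<rho>) \<or>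
       (z \<in> range ((^) K) \<and> K ^ j < z \<and> r < z \<and>
          (\<exists>\<rho>\<in>{\<rho>. \<rho> < p' \<and> blk s K j q1 \<rho> = p}. r mod p' = \<rho>))"
        using n large[of r n] base p'(1) by (cases "n \<le> j") auto
    next
      assume "(\<exists>n\<in>{..j}. \<exists>\<rho>\<in>{\<rho>. \<rho> < K ^ n \<and> blk s K n q \<rho> = p}. z = K ^ n \<and> r = \<rho>) \<or>
       (z \<in> range ((^) K) \<and> K ^ j < z \<and> r < z \<and>
          (\<exists>\<rho>\<in>{\<rho>. \<rho> < p' \<and> blk s K j q1 \<rho> = p}. r mod p' = \<rho>))"
      then show "block_rel s K q p z r"
        unfolding block_rel_def using large base by auto
    qed
    ultimately show ?thesis by (simp only:)
  next
    case (loop c0)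
    \<comment> \<open>A return through \<open>c\<close> and one through \<open>c0\<close>, prolonged
      by the loop to the same level, would be two occurrences of \<open>q\<close> in one
      image.\<close>
    have out: "q \<notin> reach (blk s K 1 q c)" if "c < K" "c \<noteq> c0" for c
    proof
      assume "q \<in> reach (blk s K 1 q c)"
      then obtain n d where d: "d < K ^ n" "q = blk s K n (blk s K 1 q c) d" by (auto simp: reach_def)
      obtain d' where d': "d' < K ^ n" "blk s K n q d' = q"
        using return_mult[of q c0 1 n] loop q by auto
      have "K ^ n * c + d = K ^ n * c0 + d'"
      proof (rule unique[OF q loop(1), of _ "1 + n"])
        show "K ^ n * c + d < K ^ (1 + n)" "K ^ n * c0 + d' < K ^ (1 + n)"
          using digits_less[of _ K 1 _ n] that loop d d' by simp_all
        show "blk s K (1 + n) q (K ^ n * c + d) = q"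
          using blk_add[of c 1 d n q] d that q by simp
        show "blk s K (1 + n) q (K ^ n * c0 + d') = q"
          using blk_add[of c0 1 d' n q] d' loop q by simp
      qed
      then have "(K ^ n * c + d) div K ^ n = (K ^ n * c0 + d') div K ^ n" by simp
      then show False using d d' that power_pos[of n] by simp
    qed
    have "definable_rel Z (\<lambda>e. t e \<in> range ((^) K) \<and>
       ((\<exists>R. (K - 1) * R + 1 = t e \<and> u e = c0 * R \<and> q = p) \<or>
       (\<exists>c\<in>{..<K} - {c0}. \<exists>z r' R. block_rel s K (blk s K 1 q c) p z r' \<and>
        (K - 1) * R + K * z = t e \<and> u e = c0 * R + c * z + r')))"
      by (intro definable_intros definable_rel_bex_finite definable_rel_const pw tu ren IH out) auto
    moreover have "block_rel s K q p z r \<longleftrightarrow> z \<in> range ((^) K) \<and>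
       ((\<exists>R. (K - 1) * R + 1 = z \<and> r = c0 * R \<and> q = p) \<or>
       (\<exists>c\<in>{..<K} - {c0}. \<exists>z' r' R. block_rel s K (blk s K 1 q c) p z' r' \<and>
        (K - 1) * R + K * z' = z \<and> r = c0 * R + c * z' + r'))" for z r
    proof -
      have "block_rel s K q p z r \<longleftrightarrow> (\<exists>n. z = K ^ n \<and> (r < K ^ n \<and> blk s K n q r = p))"
        unfolding block_rel_def by auto
      also have "\<dots> \<longleftrightarrow> z \<in> range ((^) K) \<and>
       ((\<exists>R. (K - 1) * R + 1 = z \<and> r = c0 * R \<and> q = p) \<or>
       (\<exists>c\<in>{..<K} - {c0}. \<exists>m r' R. r' < K ^ m \<and> blk s K m (blk s K 1 q c) r' = p \<and>
        (K - 1) * R + K * K ^ m = z \<and> r = c0 * R + c * K ^ m + r'))"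
        unfolding loop_iff[OF q loop(2,3)] image_iff by (simp only: UNIV_I bex_simps simp_thms) blast
      finally show ?thesis
        unfolding block_rel_def by blast
    qed
    ultimately show ?thesis by (simp only:)
  next
    case no_loop
    have out: "q \<notin> reach (blk s K 1 q c)" if "c < K" for c
    proof
      assume "q \<in> reach (blk s K 1 q c)"
      then obtain n d where "d < K ^ n" "q = blk s K n (blk s K 1 q c) d" by (auto simp: reach_def)
      then have "K ^ n * c + d < K ^ (1 + n)" "blk s K (1 + n) q (K ^ n * c + d) = q"
        using blk_add[of c 1 d n q] digits_less[of c K 1 d n] that q by simp_all
      then show False using ret[OF q, of "1 + n"] no_loop by auto
    qed
    have "definable_rel Z (\<lambda>e. (t e = 1 \<and> u e = 0 \<and> q = p) \<or> (\<exists>c\<in>{..<K}. \<exists>z r'.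
        t e = K * z \<and> u e = c * z + r' \<and> block_rel s K (blk s K 1 q c) p z r'))"
      by (intro definable_intros definable_rel_bex_finite definable_rel_const tu ren IH out) auto
    moreover have "block_rel s K q p z r \<longleftrightarrow> (z = 1 \<and> r = 0 \<and> q = p) \<or> (\<exists>c\<in>{..<K}. \<exists>z' r'.
        z = K * z' \<and> r = c * z' + r' \<and> block_rel s K (blk s K 1 q c) p z' r')" for z r
    proof -
      have "block_rel s K q p z r \<longleftrightarrow> (z = 1 \<and> r = 0 \<and> q = p) \<or>
         (\<exists>n. z = K * K ^ n \<and> (r < K ^ Suc n \<and> blk s K (Suc n) q r = p))"
      proof
        assume "block_rel s K q p z r"
        then obtain n where "z = K ^ n" "r < K ^ n" "blk s K n q r = p"
          unfolding block_rel_def by auto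
        then show "(z = 1 \<and> r = 0 \<and> q = p) \<or>
         (\<exists>n. z = K * K ^ n \<and> (r < K ^ Suc n \<and> blk s K (Suc n) q r = p))"
          using blk_0[OF q] by (cases n) auto
      next
        assume "(z = 1 \<and> r = 0 \<and> q = p) \<or>
         (\<exists>n. z = K * K ^ n \<and> (r < K ^ Suc n \<and> blk s K (Suc n) q r = p))"
        then show "block_rel s K q p z r"
          unfolding block_rel_def using blk_0[OF q]
          by (metis less_one power_0 power_Suc)
      qed
      then show ?thesis
        unfolding blk_Suc_iff[OF q] block_rel_def by (simp add: Bex_def) blast
    qed
    ultimately show ?thesis by (simp only:)
  qed
qed

end

section \<open>Recognizability\<close>

primrec sums_of :: "nat \<Rightarrow> nat set \<Rightarrow> nat set" where
  "sums_of 0 A = {0}"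
| "sums_of (Suc J) A = {a + b | a b. a \<in> A \<and> b \<in> sums_of J A}"

text \<open>Nonnegative differences of two sums of \<open>J\<close> elements each. The number
  \<open>J\<close> is fixed so that membership stays first-order in \<open>A\<close>.\<close>

definition diffs_of :: "nat \<Rightarrow> nat set \<Rightarrow> nat set" where
  "diffs_of J A = {v. \<exists>x\<in>sums_of J A. v + x \<in> sums_of J A}"

lemma sums_of_add:
  "x \<in> sums_of I A \<Longrightarrow> y \<in> sums_of J A \<Longrightarrow> x + y \<in> sums_of (I + J) A"
proof (induction I arbitrary: x)
  case (Suc I)
  then obtain a b where "x = a + b" "a \<in> A" "b \<in> sums_of I A" by auto
  then show ?case using Suc.IH[of b] Suc.prems(2) by (auto simp: add.assoc)
qed simp

lemma sums_of_mono: "A \<subseteq> B \<Longrightarrow> sums_of J A \<subseteq> sums_of J B"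
  by (induction J) auto

lemma sums_of_scale: "sums_of J ((*) c ` A) = (*) c ` sums_of J A"
proof (induction J)
  case (Suc J)
  have "sums_of (Suc J) ((*) c ` A) = {c * a + c * b | a b. a \<in> A \<and> b \<in> sums_of J A}"
    unfolding sums_of.simps(2) Suc by blast
  also have "\<dots> = (*) c ` sums_of (Suc J) A"
    unfolding sums_of.simps(2) by (force simp: distrib_left[symmetric])
  finally show ?case .
qed simp

lemma sums_of_const: "a \<in> A \<Longrightarrow> J * a \<in> sums_of J A"
  by (induction J) auto

lemma diffs_of_mono: "A \<subseteq> B \<Longrightarrow> diffs_of J A \<subseteq> diffs_of J B"
  using sums_of_mono[of A B J] by (auto simp: diffs_of_def)

lemma diffs_of_scale: "c > 0 \<Longrightarrow> diffs_of J ((*) c ` A) = (*) c ` diffs_of J A"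
proof (intro equalityI subsetI)
  fix v
  assume c: "c > 0" and "v \<in> diffs_of J ((*) c ` A)"
  then obtain x y where xy: "x \<in> sums_of J A" "y \<in> sums_of J A" "v + c * x = c * y"
    by (auto simp: diffs_of_def sums_of_scale)
  then have "c * x \<le> c * y" by linarith
  then have le: "x \<le> y" using c by simp
  then have "y - x + x \<in> sums_of J A" using xy(2) by simp
  then have "y - x \<in> diffs_of J A" using xy(1) unfolding diffs_of_def by blast
  moreover have "v = c * (y - x)" using xy(3) by (simp add: diff_mult_distrib2)
  ultimately show "v \<in> (*) c ` diffs_of J A" by blast
next
  fix v
  assume "v \<in> (*) c ` diffs_of J A"
  then obtain w x where "v = c * w" "x \<in> sums_of J A" "w + x \<in> sums_of J A"
    by (auto simp: diffs_of_def)
  then show "v \<in> diffs_of J ((*) c ` A)"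
    unfolding diffs_of_def sums_of_scale
    by (auto intro!: bexI[of _ x] image_eqI[of _ _ "w + x"] simp: distrib_left)
qed

lemma diffs_of_add:
  assumes "v \<in> diffs_of I A" "w \<in> diffs_of J A"
  shows "v + w \<in> diffs_of (I + J) A"
proof -
  obtain x y where "x \<in> sums_of I A" "v + x \<in> sums_of I A" "y \<in> sums_of J A" "w + y \<in> sums_of J A"
    using assms by (auto simp: diffs_of_def)
  then have "x + y \<in> sums_of (I + J) A" "(v + x) + (w + y) \<in> sums_of (I + J) A"
    by (simp_all add: sums_of_add)
  moreover have "(v + x) + (w + y) = (v + w) + (x + y)" by simp
  ultimately show ?thesis unfolding diffs_of_def by (metis (mono_tags, lifting) mem_Collect_eq)
qed

lemma diffs_of_diff:
  assumes "w + v \<in> diffs_of I A" "w \<in> diffs_of J A"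
  shows "v \<in> diffs_of (I + J) A"
proof -
  obtain x y where "x \<in> sums_of I A" "w + v + x \<in> sums_of I A" "y \<in> sums_of J A" "w + y \<in> sums_of J A"
    using assms by (auto simp: diffs_of_def)
  then have "x + (w + y) \<in> sums_of (I + J) A" "(w + v + x) + y \<in> sums_of (I + J) A"
    by (simp_all add: sums_of_add)
  moreover have "(w + v + x) + y = v + (x + (w + y))" by simp
  ultimately show ?thesis unfolding diffs_of_def by (metis (mono_tags, lifting) mem_Collect_eq)
qed

text \<open>Division with remainder: a nonzero remainder modulo \<open>v\<close> would be a smaller
  positive element.\<close>

lemma group_eq_multiples:
  fixes S :: "nat set"
  assumes "\<And>a b. a \<in> S \<Longrightarrow> b \<in> S \<Longrightarrow> a + b \<in> S" "\<And>a b. a \<in> S \<Longrightarrow> a + b \<in> S \<Longrightarrow> b \<in> S"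
    and v: "v \<in> S" "0 < v" "\<And>u. u \<in> S \<Longrightarrow> 0 < u \<Longrightarrow> v \<le> u"
  shows "S = {x. v dvd x}"
proof -
  have mult: "v * m \<in> S" for m
  proof (induction m)
    case 0
    then show ?case using assms(2)[of v 0] v(1) by simp
  qed (use assms(1) v(1) in simp)
  have "v dvd x" if "x \<in> S" for x
  proof (rule ccontr)
    assume "\<not> v dvd x"
    then have "x mod v > 0" by (simp add: dvd_eq_mod_eq_0)
    moreover have "x mod v \<in> S"
      using assms(2)[of "v * (x div v)" "x mod v"] mult that by simp
    ultimately show False using v(3)[of "x mod v"] mod_less_divisor[OF v(2), of x] by linarith
  qed
  then show ?thesis using mult by (auto elim: dvdE)
qed

text \<open>Modulo \<open>H\<close> only finitely many residues have to be reached, so boundedly many summands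
  generate the whole group of differences.\<close>

lemma ex_diffs_of_eq_multiples:
  assumes H: "H \<ge> 1" "\<And>m. H * m \<in> diffs_of J0 A"
  shows "\<exists>J g. g \<ge> 1 \<and> diffs_of J A = {v. g dvd v}"
proof -
  obtain a where a: "a \<in> A"
    using H(2)[of 1] H(1) by (cases J0) (auto simp: diffs_of_def)
  \<comment> \<open>Both sums are padded with \<open>J\<close> copies of \<open>a\<close>.\<close>
  have mono: "v \<in> diffs_of (I + J) A" if "v \<in> diffs_of I A" for v I J
    using diffs_of_add[OF that, of 0 J] sums_of_const[OF a, of J] by (auto simp: diffs_of_def)
  define G where "G = (\<Union>J. diffs_of J A)"
  have add: "v + w \<in> G" if "v \<in> G" "w \<in> G" for v w
  proof -
    obtain I J where "v \<in> diffs_of I A" "w \<in> diffs_of J A" using \<open>v \<in> G\<close> \<open>w \<in> G\<close> G_def by auto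
    then show ?thesis unfolding G_def using diffs_of_add by (metis UN_I UNIV_I)
  qed
  have diff: "v \<in> G" if "w + v \<in> G" "w \<in> G" for v w
  proof -
    obtain I J where "w + v \<in> diffs_of I A" "w \<in> diffs_of J A" using \<open>w + v \<in> G\<close> \<open>w \<in> G\<close> G_def by auto
    then show ?thesis unfolding G_def using diffs_of_diff by (metis UN_I UNIV_I)
  qed
  have HG: "H * m \<in> G" for m
    using H(2) unfolding G_def by blast
  define g where "g = (LEAST v. v > 0 \<and> v \<in> G)"
  have "H > 0 \<and> H \<in> G" using H(1) HG[of 1] by simp
  then have "g > 0 \<and> g \<in> G"
    unfolding g_def by (rule LeastI)
  then have g: "g > 0" "g \<in> G" by blast+
  have G: "G = {v. g dvd v}"
  proof (rule group_eq_multiples)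
    show "g \<le> u" if "u \<in> G" "0 < u" for u
      unfolding g_def using that by (intro Least_le) simp
    show "a + b \<in> G" if "a \<in> G" "b \<in> G" for a b using add[OF that] .
    show "b \<in> G" if "a \<in> G" "a + b \<in> G" for a b using diff[OF that(2,1)] .
  qed (rule g)+
  have "\<forall>r\<in>{r. r < H \<and> r \<in> G}. \<exists>J. r \<in> diffs_of J A"
    unfolding G_def by blast
  then obtain I where I: "\<And>r. r < H \<Longrightarrow> r \<in> G \<Longrightarrow> r \<in> diffs_of (I r) A"
    by (metis (mono_tags, lifting) mem_Collect_eq)
  define J where "J = (\<Sum>r<H. I r)"
  have J: "r \<in> diffs_of J A" if "r < H" "r \<in> G" for r
  proof -
    have "J = I r + (\<Sum>r\<in>{..<H} - {r}. I r)"
      unfolding J_def using that(1) by (simp add: sum.remove)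
    then show ?thesis using mono[OF I[OF that]] by metis
  qed
  have "v \<in> diffs_of (J0 + J) A" if "g dvd v" for v
  proof -
    have "v \<in> G" using that G by simp
    then have "v mod H \<in> G"
      using diff[of "H * (v div H)" "v mod H"] HG by simp
    then have "H * (v div H) + v mod H \<in> diffs_of (J0 + J) A"
      using H J by (intro diffs_of_add) auto
    then show ?thesis by simp
  qed
  then have "diffs_of (J0 + J) A = {v. g dvd v}"
    using G unfolding G_def by auto
  then show ?thesis using g(1) by (metis One_nat_def Suc_leI)
qed

lemma bounded_mono_stabilizes:
  fixes f :: "nat \<Rightarrow> nat"
  assumes "\<And>n. f n \<le> f (Suc n)" "\<And>n. n \<ge> M \<Longrightarrow> f n \<le> b"
  shows "\<exists>N. \<forall>n\<ge>N. f (Suc n) = f n"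
proof -
  have mono: "f m \<le> f n" if "m \<le> n" for m n
    using assms(1) that by (rule lift_Suc_mono_le)
  have "f n \<le> b" for n
    using mono[of n "n + M"] assms(2)[of "n + M"] by simp
  then have fin: "finite (range f)"
    by (intro finite_subset[of "range f" "{..b}"]) auto
  have "Max (range f) \<in> range f"
    using Max_in[OF fin] by simp
  then obtain N where N: "Max (range f) = f N" by blast
  have "f n = f N" if "n \<ge> N" for n
    using mono[OF that] Max_ge[OF fin, of "f n"] N by simp
  then show ?thesis by (metis le_SucI)
qed

section \<open>Periods and occurrences of iterated images\<close>

context block_coding
begin

text \<open>As \<open>q\<close> is letter \<open>c\<close> of its own image, a violation of the
  period reappears one level higher, shifted by \<open>K ^ n * c\<close>.\<close>

lemma not_uniformly_periodic_large:
  assumes q: "q \<in> range s" and c: "c < K" "blk s K 1 q c = q"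
    and "\<not> uniformly_periodic s K q" "p \<ge> 1"
  shows "\<exists>n0. \<forall>n\<ge>n0. \<exists>i. i + p < K ^ n \<and> blk s K n q (i + p) \<noteq> blk s K n q i"
proof -
  obtain n0 i where i: "i + p < K ^ n0" "blk s K n0 q (i + p) \<noteq> blk s K n0 q i"
    using assms(4,5) unfolding uniformly_periodic_def by blast
  have "\<exists>i. i + p < K ^ n \<and> blk s K n q (i + p) \<noteq> blk s K n q i" if "n \<ge> n0" for n
    using that
  proof (induction n rule: dec_induct)
    case base
    show ?case using i by blast
  next
    case (step n)
    then obtain i where i: "i + p < K ^ n" "blk s K n q (i + p) \<noteq> blk s K n q i" by blast
    have "blk s K (1 + n) q (K ^ n * c + j) = blk s K n q j" if "j < K ^ n" for j
      using blk_add[of c 1 j n q] c q that by simp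
    then have "blk s K (1 + n) q (K ^ n * c + i + p) \<noteq> blk s K (1 + n) q (K ^ n * c + i)"
      using i by (simp add: add.assoc)
    moreover have "K ^ n * c + i + p < K ^ (1 + n)"
      using digits_less[of c K 1 "i + p" n] c i by simp
    ultimately show ?case by auto
  qed
  then show ?thesis by blast
qed

text \<open>Among the first \<open>N + 1\<close> letters of the \<open>M\<close>-th image two agree,
  at distance \<open>p \<le> N\<close>. Their \<open>j\<close>-th images with
  \<open>j = n - M\<close> agree and have length at least \<open>P\<close>, so each shows a full
  period; hence the whole periodic word also has period \<open>K ^ j * p\<close>. By injectivity the
  \<open>M\<close>-th image then has period \<open>p\<close>, although \<open>M\<close> is chosen
  beyond the levels at which all \<open>p \<le> N\<close> are violated.\<close>

lemma no_small_period:
  assumes q: "q \<in> range s" and c: "c < K" "blk s K 1 q c = q" and np: "\<not> uniformly_periodic s K q"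
  shows "\<exists>M. \<forall>n\<ge>M. \<forall>P\<ge>1. P \<le> K ^ (n - M) \<longrightarrow> (\<exists>i. i + P < K ^ n \<and> blk s K n q (i + P) \<noteq> blk s K n q i)"
proof -
  define N where "N = card (range s)"
  have "\<exists>n0. \<forall>n\<ge>n0. \<exists>i. i + p < K ^ n \<and> blk s K n q (i + p) \<noteq> blk s K n q i" if "p \<ge> 1" for p
    using not_uniformly_periodic_large[OF q c np that] .
  then obtain n0 where n0: "\<And>p n. p \<ge> 1 \<Longrightarrow> n \<ge> n0 p
      \<Longrightarrow> \<exists>i. i + p < K ^ n \<and> blk s K n q (i + p) \<noteq> blk s K n q i"
    by metis
  define M where "M = N + (\<Sum>p\<le>N. n0 p)"
  have M: "M \<ge> n0 p" if "p \<le> N" for p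
  proof -
    have "n0 p \<le> (\<Sum>p\<le>N. n0 p)" using that by (intro member_le_sum) auto
    then show ?thesis by (simp add: M_def)
  qed
  have "N < K ^ N" using base by (simp add: power_gt_expt)
  also have "\<dots> \<le> K ^ M" using base by (intro power_increasing) (auto simp: M_def)
  finally have NM: "N < K ^ M" .
  have "\<exists>i. i + P < K ^ n \<and> blk s K n q (i + P) \<noteq> blk s K n q i"
    if n: "n \<ge> M" and P: "P \<ge> 1" "P \<le> K ^ (n - M)" for n P
  proof (rule ccontr)
    assume "\<not> ?thesis"
    then have per: "\<And>i. i + P < K ^ n \<Longrightarrow> blk s K n q (i + P) = blk s K n q i" by blast
    define j where "j = n - M"
    have n_eq: "n = M + j" using n by (simp add: j_def)
    \<comment> \<open>The periodic extension of the image to all positions.\<close>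
    define W where "W y = blk s K n q (y mod P)" for y
    have W: "blk s K j (blk s K M q i) t = W (K ^ j * i + t)" if "i < K ^ M" "t < K ^ j" for i t
    proof -
      have "K ^ j * i + t < K ^ n" using digits_less[OF that] by (simp add: n_eq)
      then have "blk s K n q (K ^ j * i + t) = W (K ^ j * i + t)"
        unfolding W_def using per by (intro periodic_mod[of P "K ^ n"]) auto
      then show ?thesis using blk_add[OF that q] by (simp add: n_eq)
    qed
    have "card (blk s K M q ` {..N}) \<le> N"
      unfolding N_def by (intro card_mono finite_range image_subsetI blk_in_range)
    then have "\<not> inj_on (blk s K M q) {..N}"
      by (intro pigeonhole) simp
    then obtain i i' where "i \<in> {..N}" "i' \<in> {..N}" "i < i'" "blk s K M q i = blk s K M q i'"
      unfolding inj_on_def by (metis linorder_neqE_nat)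
    then have i: "i < i'" "i' \<le> N" "blk s K M q i = blk s K M q i'" by auto
    define p where "p = i' - i"
    have p: "1 \<le> p" "p \<le> N" "i' = i + p" using i by (auto simp: p_def)
    have Wper: "W (y + K ^ j * p) = W y" for y
    proof -
      \<comment> \<open>The solution of \<open>K ^ j * i + t = y\<close> modulo \<open>P\<close>;
        the factor \<open>P - 1\<close> stands for \<open>-1\<close>.\<close>
      define t where "t = (y + K ^ j * i * (P - 1)) mod P"
      have t: "t < K ^ j" using P mod_less_divisor[of P] unfolding t_def j_def by (meson less_le_trans less_numeral_extra(1))
      have shift: "(x + t) mod P = (x + (y + K ^ j * i * (P - 1))) mod P" for x
        unfolding t_def by presburger
      have *: "K ^ j * i + (y + K ^ j * i * (P - 1)) = y + K ^ j * i * P"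
        using P(1) by (cases P) (auto simp: algebra_simps)
      have 1: "W (K ^ j * i + t) = W y"
        unfolding W_def shift * by simp
      have *: "K ^ j * i' + (y + K ^ j * i * (P - 1)) = y + K ^ j * p + K ^ j * i * P"
        using P(1) p(3) by (cases P) (auto simp: algebra_simps)
      have 2: "W (K ^ j * i' + t) = W (y + K ^ j * p)"
        unfolding W_def shift * by simp
      have "i < K ^ M" "i' < K ^ M" using i NM by auto
      then show ?thesis using W t i(3) 1 2 by metis
    qed
    obtain x where x: "x + p < K ^ M" "blk s K M q (x + p) \<noteq> blk s K M q x"
      using n0[OF p(1) M[OF p(2)]] by blast
    have "blk s K M q (x + p) = blk s K M q x"
    proof (rule blk_inj[of _ _ j])
      fix t
      assume "t < K ^ j"
      then show "blk s K j (blk s K M q (x + p)) t = blk s K j (blk s K M q x) t"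
        using W x(1) Wper[of "K ^ j * x + t"] by (simp add: algebra_simps)
    qed (rule blk_in_range)+
    then show False using x by blast
  qed
  then show ?thesis by blast
qed

text \<open>All positions count, also those not aligned with blocks of length
  \<open>K ^ n\<close>.\<close>

definition occ :: "'q \<Rightarrow> nat \<Rightarrow> nat set" where
  "occ q n = {x. \<forall>i<K ^ n. s (x + i) = blk s K n q i}"

text \<open>At a multiple of \<open>K\<close>, an occurrence consists of whole images of letters,
  and the substitution is injective on letters.\<close>

lemma occ_scale:
  assumes "q \<in> range s"
  shows "K * x \<in> occ q (Suc n) \<longleftrightarrow> x \<in> occ q n"
proof -
  have "K * x \<in> occ q (Suc n) \<longleftrightarrow> (\<forall>i<K ^ n. \<forall>c<K. s (K * (x + i) + c) = blk s K (n + 1) q (K ^ 1 * i + c))"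
    unfolding occ_def power_Suc2 mem_Collect_eq all_less_mult by (simp add: algebra_simps)
  also have "\<dots> \<longleftrightarrow> (\<forall>i<K ^ n. \<forall>c<K. s (K * (x + i) + c) = blk s K 1 (blk s K n q i) c)"
    using blk_add[of _ n _ 1 q] assms by simp
  also have "\<dots> \<longleftrightarrow> (\<forall>i<K ^ n. s (x + i) = blk s K n q i)"
  proof -
    have "blk s K 1 (blk s K n q i) c = s (K * (SOME a. s a = blk s K n q i) + c)" for i c
      by (simp add: blk_def)
    then show ?thesis
      using block_eq[of "x + _" "SOME a. s a = blk s K n q _"] rep[OF blk_in_range] by simp
  qed
  finally show ?thesis by (simp add: occ_def)
qed

text \<open>The occurrence lies within two consecutive blocks, which are determined by the letters
  \<open>s y\<close> and \<open>s (Suc y)\<close>.\<close>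

lemma occ_transfer:
  assumes "r < K ^ n" "s y = s y'" "s (Suc y) = s (Suc y')" "K ^ n * y + r \<in> occ q n"
  shows "K ^ n * y' + r \<in> occ q n"
proof -
  have "s (K ^ n * y + r + i) = s (K ^ n * y' + r + i)" if "i < K ^ n" for i
  proof (cases "r + i < K ^ n")
    case True
    then show ?thesis using blk[OF True, of y] blk[OF True, of y'] assms by (simp add: add.assoc)
  next
    case False
    define t where "t = r + i - K ^ n"
    have t: "t < K ^ n" "r + i = K ^ n + t" using False assms(1) that by (auto simp: t_def)
    have "K ^ n * z + r + i = K ^ n * Suc z + t" for z using t(2) by simp
    then show ?thesis
      using blk[OF t(1), of "Suc y"] blk[OF t(1), of "Suc y'"] assms(3) by metis
  qed
  then show ?thesis using assms(4) unfolding occ_def by simp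
qed

text \<open>Recognizability: the possible positions of an occurrence within two consecutive blocks of
  length \<open>K ^ n\<close> are multiplied by \<open>K\<close> from level \<open>n\<close> to level \<open>n + 1\<close>, and their number is bounded as
  there is no small period. So from some level on, there are no others.\<close>

lemma occ_Suc_eventually:
  assumes q: "q \<in> range s" and c: "c < K" "blk s K 1 q c = q" and np: "\<not> uniformly_periodic s K q"
  shows "\<exists>N0. \<forall>n\<ge>N0. occ q (Suc n) = (*) K ` occ q n"
proof -
  obtain M where M: "\<And>n P. n \<ge> M \<Longrightarrow> P \<ge> 1 \<Longrightarrow> P \<le> K ^ (n - M)
      \<Longrightarrow> \<exists>i. i + P < K ^ n \<and> blk s K n q (i + P) \<noteq> blk s K n q i"
    using no_small_period[OF assms] by blast
  define R where "R n = {(s y, s (Suc y), r) | y r. r < K ^ n \<and> K ^ n * y + r \<in> occ q n}" for n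
  have "R n \<subseteq> range s \<times> range s \<times> {..<K ^ n}" for n
    by (auto simp: R_def)
  then have finR: "finite (R n)" for n
    by (rule finite_subset) (use finite_range in auto)
  define up where "up = (\<lambda>(a :: 'q, b :: 'q, r). (a, b, K * r))"
  have inj: "inj_on up (R n)" for n
    using base by (auto simp: up_def inj_on_def)
  have sub: "up ` R n \<subseteq> R (Suc n)" for n
  proof
    fix z
    assume "z \<in> up ` R n"
    then obtain y r where z: "z = (s y, s (Suc y), K * r)" "r < K ^ n" "K ^ n * y + r \<in> occ q n"
      by (auto simp: R_def up_def)
    then have "K * (K ^ n * y + r) \<in> occ q (Suc n)" using occ_scale[OF q] by blast
    then have "K ^ Suc n * y + K * r \<in> occ q (Suc n)" by (simp add: algebra_simps)
    moreover have "K * r < K ^ Suc n" using z(2) base by simp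
    ultimately show "z \<in> R (Suc n)" using z(1) unfolding R_def by blast
  qed
  \<comment> \<open>Over the same pair of letters, both occurrences can be moved to the same place;
    their distance is then a period of the image.\<close>
  have close: "r = r'" if prems: "n \<ge> M" "(a, b, r) \<in> R n" "(a, b, r') \<in> R n" "r \<le> r'" "r' - r < K ^ (n - M)"
    for n a b r r'
  proof (rule ccontr)
    assume "r \<noteq> r'"
    define P where "P = r' - r"
    have P: "P \<ge> 1" "r' = r + P" using \<open>r \<noteq> r'\<close> prems(4) by (auto simp: P_def)
    obtain y y' where y: "a = s y" "b = s (Suc y)" "K ^ n * y + r \<in> occ q n"
      "a = s y'" "b = s (Suc y')" "r' < K ^ n" "K ^ n * y' + r' \<in> occ q n"
      using prems(2,3) unfolding R_def by blast
    then have "K ^ n * y + r' \<in> occ q n" using occ_transfer[of r' n y' y q] by simp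
    then have "blk s K n q (i + P) = blk s K n q i" if "i + P < K ^ n" for i
    proof -
      have "blk s K n q (i + P) = s (K ^ n * y + r + (i + P))"
        using y(3) that unfolding occ_def by simp
      also have "\<dots> = s (K ^ n * y + r' + i)"
        by (simp add: P(2) algebra_simps)
      also have "\<dots> = blk s K n q i"
        using \<open>K ^ n * y + r' \<in> occ q n\<close> that unfolding occ_def by simp
      finally show ?thesis .
    qed
    then show False using M[OF prems(1) P(1)] prems(5) by (auto simp: P_def)
  qed
  have bound: "card (R n) \<le> card (range s \<times> range s \<times> {..<K ^ M})" if "n \<ge> M" for n
  proof (rule card_inj_on_le)
    \<comment> \<open>The offsets are cut into \<open>K ^ M\<close> intervals of length
      \<open>K ^ (n - M)\<close>, each of which contains at most one offset per pair of
      letters.\<close>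
    let ?f = "\<lambda>(a, b, r). (a, b, r div K ^ (n - M))"
    show "finite (range s \<times> range s \<times> {..<K ^ M})" using finite_range by auto
    have "K ^ n = K ^ M * K ^ (n - M)" using that by (simp flip: power_add)
    then show "?f ` R n \<subseteq> range s \<times> range s \<times> {..<K ^ M}"
      by (auto simp: R_def less_mult_imp_div_less)
    have near: "r' - r < K ^ (n - M)" if "r div K ^ (n - M) = r' div K ^ (n - M)" for r r'
    proof -
      have "r' < K ^ (n - M) * (r' div K ^ (n - M)) + K ^ (n - M)"
        using power_pos[of "n - M"] by (metis add_strict_left_mono mod_less_divisor mult_div_mod_eq)
      moreover have "K ^ (n - M) * (r' div K ^ (n - M)) \<le> r"
        using that by (metis times_div_less_eq_dividend)
      ultimately show ?thesis using power_pos[of "n - M"] by linarith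
    qed
    show "inj_on ?f (R n)"
    proof (rule inj_onI)
      fix z z'
      assume z: "z \<in> R n" "z' \<in> R n" and eq: "?f z = ?f z'"
      obtain a b r r' where z_eq: "z = (a, b, r)" "z' = (a, b, r')"
        and div: "r div K ^ (n - M) = r' div K ^ (n - M)"
        using eq by (cases z; cases z') auto
      show "z = z'"
      proof (cases "r \<le> r'")
        case True
        then show ?thesis using close[OF \<open>n \<ge> M\<close>, of a b r r'] near[OF div] z unfolding z_eq by blast
      next
        case False
        then have "r' = r"
          using close[OF \<open>n \<ge> M\<close>, of a b r' r] near[OF div[symmetric]] z unfolding z_eq by simp
        then show ?thesis by (simp add: z_eq)
      qed
    qed
  qed
  have "card (R n) \<le> card (R (Suc n))" for n
    using card_mono[OF finR sub] card_image[OF inj] by metis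
  then obtain N0 where N0: "\<And>n. n \<ge> N0 \<Longrightarrow> card (R (Suc n)) = card (R n)"
    using bounded_mono_stabilizes[of "\<lambda>n. card (R n)"] bound by metis
  have "occ q (Suc n) = (*) K ` occ q n" if "n \<ge> N0" for n
  proof (intro equalityI subsetI)
    fix x
    assume x: "x \<in> occ q (Suc n)"
    have "up ` R n = R (Suc n)"
      by (intro card_subset_eq finR sub) (simp add: card_image[OF inj] N0[OF that])
    moreover have "(s (x div K ^ Suc n), s (Suc (x div K ^ Suc n)), x mod K ^ Suc n) \<in> R (Suc n)"
    proof -
      have "K ^ Suc n * (x div K ^ Suc n) + x mod K ^ Suc n \<in> occ q (Suc n)"
        unfolding mult_div_mod_eq by (rule x)
      moreover have "x mod K ^ Suc n < K ^ Suc n" using power_pos by (rule mod_less_divisor)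
      ultimately show ?thesis unfolding R_def by blast
    qed
    ultimately obtain z where "(s (x div K ^ Suc n), s (Suc (x div K ^ Suc n)), x mod K ^ Suc n) = up z"
      by (metis imageE)
    moreover define r where "r = snd (snd z)"
    ultimately have r: "x mod K ^ Suc n = K * r"
      by (cases z) (simp add: up_def del: power_Suc)
    have "x = K ^ Suc n * (x div K ^ Suc n) + K * r"
      unfolding r[symmetric] by (rule mult_div_mod_eq[symmetric])
    then have "x = K * (K ^ n * (x div K ^ Suc n) + r)"
      by (simp add: algebra_simps)
    then show "x \<in> (*) K ` occ q n"
      using x occ_scale[OF q] by (metis image_eqI)
  qed (use occ_scale[OF q] in auto)
  then show ?thesis by blast
qed

end

text \<open>The word is given by a position \<open>y\<close> and a length \<open>l\<close>, so that
  formulas can quantify over the factors of \<open>s\<close>.\<close>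

definition factor_occ :: "(nat \<Rightarrow> 'q) \<Rightarrow> nat \<Rightarrow> nat \<Rightarrow> nat set" where
  "factor_occ s y l = {x. \<forall>i<l. s (x + i) = s (y + i)}"

text \<open>Divisibility is not definable a priori: a multiple of \<open>v\<close> is an element of a definable group
  whose least positive element is \<open>v\<close>.\<close>

definition occ_dvd :: "(nat \<Rightarrow> 'q) \<Rightarrow> nat \<Rightarrow> nat \<Rightarrow> nat \<Rightarrow> bool" where
  "occ_dvd s J v x \<longleftrightarrow> (\<exists>y l.
     (\<forall>a b. a \<in> diffs_of J (factor_occ s y l) \<and> b \<in> diffs_of J (factor_occ s y l)
        \<longrightarrow> a + b \<in> diffs_of J (factor_occ s y l)) \<and>
     (\<forall>a b. a \<in> diffs_of J (factor_occ s y l) \<and> a + b \<in> diffs_of J (factor_occ s y l)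
        \<longrightarrow> b \<in> diffs_of J (factor_occ s y l)) \<and>
     v \<in> diffs_of J (factor_occ s y l) \<and> 0 < v \<and>
     (\<forall>u. u \<in> diffs_of J (factor_occ s y l) \<and> 0 < u \<longrightarrow> v \<le> u) \<and>
     x \<in> diffs_of J (factor_occ s y l))"

lemma occ_dvd_imp:
  assumes "occ_dvd s J v x"
  shows "0 < v \<and> v dvd x \<and> (\<forall>y. v dvd y \<longrightarrow> occ_dvd s J v y)"
proof -
  obtain y l where *: "\<forall>a b. a \<in> diffs_of J (factor_occ s y l) \<and> b \<in> diffs_of J (factor_occ s y l)
        \<longrightarrow> a + b \<in> diffs_of J (factor_occ s y l)"
     "\<forall>a b. a \<in> diffs_of J (factor_occ s y l) \<and> a + b \<in> diffs_of J (factor_occ s y l)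
        \<longrightarrow> b \<in> diffs_of J (factor_occ s y l)"
     "v \<in> diffs_of J (factor_occ s y l)" "0 < v"
     "\<forall>u. u \<in> diffs_of J (factor_occ s y l) \<and> 0 < u \<longrightarrow> v \<le> u"
     "x \<in> diffs_of J (factor_occ s y l)"
    using assms unfolding occ_dvd_def by (elim exE conjE) (rule that)
  have eq: "diffs_of J (factor_occ s y l) = {x. v dvd x}"
    by (rule group_eq_multiples) (use * in blast)+
  have "occ_dvd s J v z" if "v dvd z" for z
    unfolding occ_dvd_def
  proof (rule exI[of _ y], rule exI[of _ l], intro conjI)
    show "z \<in> diffs_of J (factor_occ s y l)" using that eq by simp
  qed (fact *)+
  then show ?thesis using *(4,6) eq by blast
qed

lemma occ_dvd_if_eq_multiples:
  assumes "diffs_of J (factor_occ s y l) = {x. v dvd x}" "v > 0"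
  shows "occ_dvd s J v v"
  unfolding occ_dvd_def
  by (rule exI[of _ y], rule exI[of _ l], unfold assms(1))
     (use assms(2) in \<open>auto simp: dvd_add_right_iff dest: dvd_imp_le\<close>)

section \<open>Definability of the divisibility relation\<close>

lemma definable_rel_sums_of:
  assumes F: "\<And>t y l. definable_fun Z t \<Longrightarrow> definable_fun Z y \<Longrightarrow> definable_fun Z l \<Longrightarrow> definable_rel Z (\<lambda>e. t e \<in> F (y e) (l e))"
    and "definable_fun Z t" "definable_fun Z y" "definable_fun Z l"
  shows "definable_rel Z (\<lambda>e. t e \<in> sums_of J (F (y e) (l e)))"
  using assms(2-4)
proof (induction J arbitrary: t y l)
  case 0
  then show ?case by (simp add: definable_rel_eq definable_fun_const)
next
  case (Suc J)
  note ren = Suc.prems[THEN definable_fun_ren]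
  have "definable_rel Z (\<lambda>e. \<exists>a b. t e = a + b \<and> a \<in> F (y e) (l e) \<and> b \<in> sums_of J (F (y e) (l e)))"
    by (intro definable_intros F Suc.IH ren)
  then show ?case by (simp only: sums_of.simps mem_Collect_eq)
qed

lemma definable_rel_diffs_of:
  assumes F: "\<And>t y l. definable_fun Z t \<Longrightarrow> definable_fun Z y \<Longrightarrow> definable_fun Z l \<Longrightarrow> definable_rel Z (\<lambda>e. t e \<in> F (y e) (l e))"
    and "definable_fun Z t" "definable_fun Z y" "definable_fun Z l"
  shows "definable_rel Z (\<lambda>e. t e \<in> diffs_of J (F (y e) (l e)))"
proof -
  note ren = assms(2-4)[THEN definable_fun_ren]
  have "definable_rel Z (\<lambda>e. \<exists>x. x \<in> sums_of J (F (y e) (l e)) \<and> t e + x \<in> sums_of J (F (y e) (l e)))"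
    by (intro definable_intros definable_rel_sums_of[of Z F] F ren)
  then show ?thesis by (simp only: diffs_of_def mem_Collect_eq Bex_def)
qed

lemma definable_rel_occ_dvd:
  assumes s: "\<And>t u. definable_fun Z t \<Longrightarrow> definable_fun Z u \<Longrightarrow> definable_rel Z (\<lambda>e. s (t e) = s (u e))"
    and "definable_fun Z t" "definable_fun Z u"
  shows "definable_rel Z (\<lambda>e. occ_dvd s J (t e) (u e))"
proof -
  have F: "definable_rel Z (\<lambda>e. t e \<in> factor_occ s (y e) (l e))" if "definable_fun Z t" "definable_fun Z y" "definable_fun Z l" for t y l
  proof -
    note ren = that[THEN definable_fun_ren]
    have "definable_rel Z (\<lambda>e. \<forall>i. i < l e \<longrightarrow> s (t e + i) = s (y e + i))"
      by (intro definable_intros s ren)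
    then show ?thesis by (simp only: factor_occ_def mem_Collect_eq)
  qed
  note ren = assms(2,3)[THEN definable_fun_ren]
  note D = definable_rel_diffs_of[of Z "factor_occ s", OF F]
  show ?thesis
    unfolding occ_dvd_def by (intro definable_intros D ren)
qed

section \<open>Divisors obtained from a letter that occurs twice in its image\<close>

context block_coding
begin

lemma occ_add_eventually:
  assumes "\<forall>n\<ge>N0. occ q (Suc n) = (*) K ` occ q n"
  shows "occ q (N0 + i) = (*) (K ^ i) ` occ q N0"
proof (induction i)
  case (Suc i)
  have "occ q (N0 + Suc i) = (*) K ` (*) (K ^ i) ` occ q N0"
    using assms Suc by simp
  then show ?case by (simp add: image_image mult.assoc)
qed simp

text \<open>In a sum of \<open>J\<close> elements, the digit \<open>c + e\<close> is appended to
  \<open>d\<close> of the summands and \<open>c\<close> to the others.\<close>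

lemma sums_of_digits:
  assumes "\<And>a. a \<in> A \<Longrightarrow> K * a + c \<in> A" "\<And>a. a \<in> A \<Longrightarrow> K * a + (c + e) \<in> A"
    and "x \<in> sums_of J A" "d \<le> J"
  shows "K * x + J * c + d * e \<in> sums_of J A"
  using assms(3,4)
proof (induction J arbitrary: x d)
  case (Suc J)
  then obtain a b where x: "x = a + b" "a \<in> A" "b \<in> sums_of J A" by auto
  show ?case
  proof (cases d)
    case 0
    have "K * b + J * c + 0 * e \<in> sums_of J A" by (rule Suc.IH[OF x(3)]) simp
    moreover have "K * x + Suc J * c + d * e = (K * a + c) + (K * b + J * c + 0 * e)"
      by (simp add: x(1) 0 algebra_simps)
    ultimately show ?thesis using assms(1)[OF x(2)] unfolding sums_of.simps by blast
  next
    case (Suc d')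
    have "K * b + J * c + d' * e \<in> sums_of J A"
      by (rule Suc.IH[OF x(3)]) (use Suc.prems Suc in simp)
    moreover have "K * x + Suc J * c + d * e = (K * a + (c + e)) + (K * b + J * c + d' * e)"
      by (simp add: x(1) Suc algebra_simps)
    ultimately show ?thesis using assms(2)[OF x(2)] unfolding sums_of.simps by blast
  qed
qed simp

text \<open>The differences of two numbers with digits in \<open>{c, c + e}\<close> include all \<open>e\<close>-fold multiples of
  numbers with digits in \<open>{0, 1}\<close>, and \<open>K - 1\<close> of the latter add up to any number.\<close>

lemma multiples_in_diffs_of:
  assumes A: "a \<in> A" "\<And>a. a \<in> A \<Longrightarrow> K * a + c \<in> A" "\<And>a. a \<in> A \<Longrightarrow> K * a + (c + e) \<in> A"
  shows "e * m \<in> diffs_of (K - 1) A"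
proof (induction m rule: less_induct)
  case (less m)
  show ?case
  proof (cases "m = 0")
    case True
    then show ?thesis using sums_of_const[OF A(1), of "K - 1"] by (auto simp: diffs_of_def)
  next
    case False
    define m1 d where "m1 = m div K" and "d = m mod K"
    have m: "m = K * m1 + d" "d \<le> K - 1" "m1 < m"
      using False base by (auto simp: m1_def d_def less_Suc_eq_le[symmetric])
    obtain x where x: "x \<in> sums_of (K - 1) A" "e * m1 + x \<in> sums_of (K - 1) A"
      using less[OF m(3)] by (auto simp: diffs_of_def)
    have "K * x + (K - 1) * c + 0 * e \<in> sums_of (K - 1) A"
      "K * (e * m1 + x) + (K - 1) * c + d * e \<in> sums_of (K - 1) A"
      using sums_of_digits[OF A(2,3) x(1), of 0] sums_of_digits[OF A(2,3) x(2) m(2)] by simp_all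
    moreover have "K * (e * m1 + x) + (K - 1) * c + d * e = e * m + (K * x + (K - 1) * c + 0 * e)"
      by (simp add: m(1) algebra_simps)
    ultimately show ?thesis unfolding diffs_of_def by (metis (mono_tags, lifting) mem_Collect_eq)
  qed
qed

text \<open>The positions of \<open>q\<close> in \<open>s\<close> are closed under appending the
  digits \<open>c\<close> and \<open>c'\<close>, so their differences contain all multiples of
  \<open>e\<close>. Scaled by \<open>K ^ N0\<close>, these are differences of occurrences at level
  \<open>N0\<close>, which yields \<open>J\<close> and \<open>g\<close>. From level
  \<open>N0\<close> on, occurrence sets are scaled by \<open>K\<close> at each step, so the same
  \<open>J\<close> works at all levels while \<open>g\<close> becomes
  \<open>K ^ i * g\<close>.\<close>

lemma ex_occ_dvd:
  assumes q: "q \<in> range s" and c: "c < c'" "c' < K" "blk s K 1 q c = q" "blk s K 1 q c' = q"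
    and np: "\<not> uniformly_periodic s K q"
  shows "\<exists>J g. g \<ge> 1 \<and> (\<forall>i. occ_dvd s J (K ^ i * g) (K ^ i * g))"
proof -
  have "c < K" using c by simp
  obtain N0 where N0: "\<forall>n\<ge>N0. occ q (Suc n) = (*) K ` occ q n"
    using occ_Suc_eventually[OF q \<open>c < K\<close> c(3) np] by blast
  define e where "e = c' - c"
  define A where "A = {a. s a = q}"
  obtain a0 where a0: "a0 \<in> A" using q by (auto simp: A_def)
  have step: "K * a + d \<in> A" if "a \<in> A" "d < K" "blk s K 1 q d = q" for a d
    using blk[of d 1 a] that by (simp add: A_def)
  have "e * m \<in> diffs_of (K - 1) A" for m
    using multiples_in_diffs_of[OF a0, of c e m] step c by (simp add: e_def)
  moreover have AO: "(*) (K ^ N0) ` A \<subseteq> occ q N0"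
    by (auto simp: occ_def A_def blk)
  ultimately have "K ^ N0 * (e * m) \<in> diffs_of (K - 1) (occ q N0)" for m
    using diffs_of_mono[OF AO] diffs_of_scale[OF power_pos[of N0], of "K - 1" A] by blast
  then have "(K ^ N0 * e) * m \<in> diffs_of (K - 1) (occ q N0)" for m
    by (simp add: mult.assoc)
  moreover have "K ^ N0 * e \<ge> 1" using base c by (simp add: e_def)
  ultimately obtain J g where g: "g \<ge> 1" "diffs_of J (occ q N0) = {v. g dvd v}"
    using ex_diffs_of_eq_multiples[of "K ^ N0 * e" "K - 1"] by blast
  have "occ_dvd s J (K ^ i * g) (K ^ i * g)" for i
  proof (rule occ_dvd_if_eq_multiples)
    have "factor_occ s (K ^ (N0 + i) * a0) (K ^ (N0 + i)) = occ q (N0 + i)"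
      using a0 by (auto simp: factor_occ_def occ_def A_def blk)
    then have "diffs_of J (factor_occ s (K ^ (N0 + i) * a0) (K ^ (N0 + i))) = (*) (K ^ i) ` {v. g dvd v}"
      using occ_add_eventually[OF N0, of i] diffs_of_scale[OF power_pos[of i], of J "occ q N0"] g(2) by simp
    also have "\<dots> = {v. K ^ i * g dvd v}"
      by (auto elim!: dvdE simp: mult.assoc)
    finally show "diffs_of J (factor_occ s (K ^ (N0 + i) * a0) (K ^ (N0 + i))) = {v. K ^ i * g dvd v}" .
    show "0 < K ^ i * g" using g(1) power_pos[of i] by simp
  qed
  then show ?thesis using g(1) by blast
qed

end

section \<open>From divisibility to powers of the base\<close>

text \<open>If the gcd does not grow from \<open>K ^ T\<close> to \<open>K ^ Suc T\<close>, then its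
  cofactor in \<open>h\<close> is prime to \<open>K\<close> and divides a power of \<open>K\<close>,
  hence is \<open>1\<close>. Until then the gcd at least doubles.\<close>

lemma dvd_power_or_gcd_large:
  fixes h K :: nat
  assumes "h dvd K ^ a"
  shows "h dvd K ^ T \<or> 2 ^ T \<le> gcd h (K ^ T)"
proof (induction T)
  case (Suc T)
  define g g' where "g = gcd h (K ^ T)" and "g' = gcd h (K ^ Suc T)"
  show ?case
  proof (cases "h dvd K ^ T")
    case True
    then show ?thesis by simp
  next
    case False
    then have "h \<noteq> 1" and g: "2 ^ T \<le> g" using Suc by (auto simp: g_def)
    then have g0: "g > 0" by (metis gr0I not_le zero_less_numeral zero_less_power)
    have "g dvd g'" unfolding g_def g'_def by simp
    then obtain w where w: "g' = g * w" by blast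
    show ?thesis
    proof (cases "w = 1")
      case True
      obtain h1 t1 where h1: "h = g * h1" and t1: "K ^ T = g * t1"
        unfolding g_def by (metis dvd_def gcd_dvd1 gcd_dvd2)
      have "gcd (g * h1) (g * (K * t1)) = g"
        using True w unfolding g'_def by (simp add: h1[symmetric] t1 mult.left_commute)
      then have "g * gcd h1 (K * t1) = g"
        by (simp add: gcd_mult_distrib_nat)
      then have "coprime h1 (K * t1)"
        using g0 by (simp add: coprime_iff_gcd_eq_1)
      then have "coprime h1 (K ^ a)" by simp
      moreover have "h1 dvd K ^ a" using assms h1 by (metis dvd_mult_right)
      ultimately have "h1 = 1" by (metis coprime_common_divisor dvd_refl nat_dvd_1_iff_1)
      then have "h dvd K ^ T" using h1 t1 by simp
      then show ?thesis using False by simp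
    next
      case w1: False
      show ?thesis
      proof (cases "w = 0")
        case True
        then have "g' = 0" using w by simp
        then have "K ^ Suc T = 0" unfolding g'_def by simp
        then show ?thesis by (metis dvd_0_right)
      next
        case False
        then have "2 * g \<le> g'" using w w1 by (cases w) auto
        then show ?thesis using g by (simp add: g'_def)
      qed
    qed
  qed
qed simp

text \<open>The number of residual sets \<open>{y. v dvd K ^ j * y + r}\<close> is the part of \<open>v\<close> prime to \<open>K\<close>.\<close>

lemma divisors_almost_smooth:
  fixes R :: "nat \<Rightarrow> nat \<Rightarrow> bool"
  assumes K: "K \<ge> 2"
    and fin: "finite {\<lambda>x y. R (K ^ j * x + r) (K ^ j * y + r') | j r r'. r < K ^ j \<and> r' < K ^ j}"
    and R: "\<And>v x. R v v \<Longrightarrow> R v x \<longleftrightarrow> v dvd x" and v: "R v v" "v > 0"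
  shows "\<exists>v' h j. v = v' * h \<and> h dvd K ^ j
    \<and> v' \<le> card {\<lambda>x y. R (K ^ j * x + r) (K ^ j * y + r') | j r r'. r < K ^ j \<and> r' < K ^ j}"
proof -
  let ?C = "{\<lambda>x y. R (K ^ j * x + r) (K ^ j * y + r') | j r r'. r < K ^ j \<and> r' < K ^ j}"
  have "v < K ^ v" using K by (simp add: power_gt_expt)
  then obtain j where j: "v < K ^ j" by blast
  define h where "h = gcd v (K ^ j)"
  have h: "h > 0" using v(2) by (simp add: h_def)
  obtain v' t where v': "v = v' * h" "K ^ j = t * h" "coprime v' t"
    using gcd_coprime_exists[of v "K ^ j"] h unfolding h_def by auto
  have "t \<noteq> 0" using v'(2) K by (metis mult_0 not_numeral_le_zero power_not_zero)
  \<comment> \<open>At \<open>x = 0\<close> the first argument is \<open>v\<close>, so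
    \<open>f i 0\<close> is a residue class for divisibility by \<open>v\<close>.\<close>
  define f where "f i = (\<lambda>x y. R (K ^ j * x + v) (K ^ j * y + h * i))" for i
  have hi: "h * i < K ^ j" if "i < v'" for i
  proof -
    have "h * i < h * v'" using that h by simp
    also have "\<dots> = v" using v'(1) by (simp add: mult.commute)
    finally show ?thesis using j by simp
  qed
  have f_iff: "f i 0 y \<longleftrightarrow> v' dvd t * y + i" for i y
  proof -
    have "K ^ j * y + h * i = (t * y + i) * h" by (simp add: v'(2) algebra_simps)
    then have "f i 0 y \<longleftrightarrow> v dvd (t * y + i) * h"
      using R[OF v(1)] by (simp add: f_def)
    then show ?thesis using h by (subst (asm) v'(1)) simp
  qed
  have inj: "inj_on f {..<v'}"
  proof (rule inj_onI)
    fix i i'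
    assume i: "i \<in> {..<v'}" "i' \<in> {..<v'}" "f i = f i'"
    \<comment> \<open>\<open>x\<close> inverts \<open>t\<close> modulo \<open>v'\<close>, so
      \<open>x * (v' - i)\<close> solves \<open>t * y + i = 0\<close> modulo \<open>v'\<close>. This
      solution separates \<open>i\<close> from \<open>i'\<close>.\<close>
    obtain x y where "t * x = v' * y + gcd t v'"
      using bezout_nat[OF \<open>t \<noteq> 0\<close>] by blast
    then have xy: "t * x = v' * y + 1"
      using v'(3) by (simp add: coprime_iff_gcd_eq_1 gcd.commute)
    have "t * (x * (v' - i)) + i = (v' * y + 1) * (v' - i) + i"
      by (simp only: mult.assoc[symmetric] xy)
    also have "\<dots> = v' * (y * (v' - i)) + ((v' - i) + i)"
      by (simp only: distrib_right mult.assoc mult_1 add.assoc)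
    also have "\<dots> = v' * (y * (v' - i) + 1)"
      using i(1) by simp
    finally have 1: "v' dvd t * (x * (v' - i)) + i" by simp
    then have 2: "v' dvd t * (x * (v' - i)) + i'"
      using f_iff i(3) by metis
    have "v' dvd i' - i" using dvd_diff_nat[OF 2 1] by simp
    moreover have "v' dvd i - i'" using dvd_diff_nat[OF 1 2] by simp
    ultimately show "i = i'"
      using i(1,2) dvd_imp_le[of v' "i' - i"] dvd_imp_le[of v' "i - i'"]
      by (cases i i' rule: linorder_cases) auto
  qed
  have "f ` {..<v'} \<subseteq> ?C"
  proof safe
    fix i assume "i < v'"
    then show "\<exists>l r r'. f i = (\<lambda>x y. R (K ^ l * x + r) (K ^ l * y + r')) \<and> r < K ^ l \<and> r' < K ^ l"
      unfolding f_def using hi[of i] j by (intro exI[of _ j] exI[of _ v] exI[of _ "h * i"] conjI refl) auto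
  qed
  then have "card {..<v'} \<le> card ?C"
    by (rule card_inj_on_le[OF inj _ fin])
  then have "v' \<le> card ?C" by simp
  moreover have "h dvd K ^ j" by (simp add: h_def)
  ultimately show ?thesis using v'(1) by blast
qed

text \<open>Let \<open>J\<close> be the position of the leading digit of \<open>v\<close>. Among the
  positions \<open>J - N\<close> to \<open>J\<close>, two cut off low parts with the same kernel
  element, so the block \<open>m\<close> of \<open>L\<close> digits between them can be repeated
  \<open>t\<close> times; \<open>t = 1\<close> gives back \<open>v\<close>. The equation describes
  the pumped low part \<open>r\<close>, a geometric sum, without division.\<close>

lemma kernel_pump:
  assumes K: "K \<ge> 2" and fin: "finite (kernel K P)" and v: "v \<in> P" "v \<ge> K ^ card (kernel K P)"
  shows "\<exists>i L m y. L \<ge> 1 \<and> y \<ge> 1 \<and> v = K ^ (i + L) * y + (K ^ i * m + v mod K ^ i)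
    \<and> v < K ^ (i + card (kernel K P) + 1)
    \<and> (\<forall>t. \<exists>r. K ^ (i + t * L) * y + r \<in> P
          \<and> (K ^ L - 1) * r + K ^ i * m = (K ^ L - 1) * (v mod K ^ i) + K ^ (i + t * L) * m)"
proof -
  define N where "N = card (kernel K P)"
  have "K ^ N > 0" using K by simp
  then have "v > 0" using v(2) unfolding N_def by linarith
  have "v < K ^ v" using K by (simp add: power_gt_expt)
  define J where "J = (GREATEST J. K ^ J \<le> v)"
  have bnd: "\<forall>J. K ^ J \<le> v \<longrightarrow> J \<le> v"
  proof safe
    fix J assume "K ^ J \<le> v"
    then have "K ^ J < K ^ v" using \<open>v < K ^ v\<close> by simp
    then show "J \<le> v" using K by (simp add: power_less_imp_less_exp less_imp_le)
  qed
  have J: "K ^ J \<le> v"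
    unfolding J_def by (rule GreatestI_nat[of _ 0 v]) (use bnd \<open>v > 0\<close> in auto)
  have NJ: "N \<le> J"
    unfolding J_def by (rule Greatest_le_nat[of _ _ v]) (use bnd v(2) N_def in auto)
  have J': "v < K ^ Suc J"
    using Greatest_le_nat[of "\<lambda>J. K ^ J \<le> v" "Suc J" v] bnd unfolding J_def[symmetric] by (meson not_le not_less_eq_eq order_refl)
  define f where "f j = (\<lambda>a. K ^ j * a + v mod K ^ j \<in> P)" for j
  have "f j \<in> kernel K P" for j
    unfolding f_def kernel_def using K by (intro CollectI exI[of _ j] exI[of _ "v mod K ^ j"]) simp
  then have "card (f ` {J - N..J}) \<le> N"
    unfolding N_def by (intro card_mono fin) auto
  then have "\<not> inj_on f {J - N..J}"
    using NJ by (intro pigeonhole) simp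
  then obtain i j where "i \<in> {J - N..J}" "j \<in> {J - N..J}" "i < j" "f i = f j"
    unfolding inj_on_def by (metis linorder_neqE_nat)
  then have ij: "J - N \<le> i" "j \<le> J" "i < j" and f: "f i = f j" by auto
  define L where "L = j - i"
  define y where "y = v div K ^ j"
  define m where "m = v div K ^ i mod K ^ L"
  have j: "j = i + L" and L: "L \<ge> 1" using ij by (auto simp: L_def)
  have vj: "v mod K ^ j = K ^ i * m + v mod K ^ i"
    unfolding j m_def power_add by (simp add: mod_mult2_eq)
  have "K ^ j \<le> K ^ J" using ij(2) K by (intro power_increasing) auto
  then have "K ^ j \<le> v" using J by linarith
  then have y: "y \<ge> 1" using K by (simp add: y_def div_greater_zero_iff Suc_le_eq)
  have v_eq: "v = K ^ (i + L) * y + (K ^ i * m + v mod K ^ i)"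
    unfolding vj[symmetric] j[symmetric] y_def by simp
  have "K ^ Suc J \<le> K ^ (i + N + 1)"
    using ij NJ K by (intro power_increasing) auto
  then have v_less: "v < K ^ (i + N + 1)" using J' by linarith
  have loop: "K ^ i * (K ^ L * a + m) + v mod K ^ i \<in> P \<longleftrightarrow> K ^ i * a + v mod K ^ i \<in> P" for a
  proof -
    have "K ^ i * (K ^ L * a + m) + v mod K ^ i = K ^ j * a + v mod K ^ j"
      unfolding vj by (simp add: j power_add algebra_simps)
    then show ?thesis using fun_cong[OF f, of a] unfolding f_def by simp
  qed
  have pump: "\<exists>r. (\<forall>a. K ^ (i + t * L) * a + r \<in> P \<longleftrightarrow> K ^ i * a + v mod K ^ i \<in> P)
      \<and> (K ^ L - 1) * r + K ^ i * m = (K ^ L - 1) * (v mod K ^ i) + K ^ (i + t * L) * m" for t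
  proof (induction t)
    case 0
    show ?case by (rule exI[of _ "v mod K ^ i"]) simp
  next
    case (Suc t)
    then obtain r where r: "\<And>a. K ^ (i + t * L) * a + r \<in> P \<longleftrightarrow> K ^ i * a + v mod K ^ i \<in> P"
      "(K ^ L - 1) * r + K ^ i * m = (K ^ L - 1) * (v mod K ^ i) + K ^ (i + t * L) * m"
      by blast
    have *: "K ^ (i + Suc t * L) * a + (r + K ^ (i + t * L) * m) = K ^ (i + t * L) * (K ^ L * a + m) + r" for a
      by (simp add: power_add algebra_simps)
    have "\<forall>a. K ^ (i + Suc t * L) * a + (r + K ^ (i + t * L) * m) \<in> P \<longleftrightarrow> K ^ i * a + v mod K ^ i \<in> P"
      unfolding * r(1) loop by blast
    moreover have "(K ^ L - 1) * (r + K ^ (i + t * L) * m) + K ^ i * m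
        = (K ^ L - 1) * (v mod K ^ i) + K ^ (i + Suc t * L) * m"
    proof -
      obtain w where w: "K ^ L = Suc w" using K by (cases "K ^ L") auto
      have "(K ^ L - 1) * (r + K ^ (i + t * L) * m) + K ^ i * m
          = ((K ^ L - 1) * r + K ^ i * m) + (K ^ L - 1) * (K ^ (i + t * L) * m)"
        by (simp add: algebra_simps)
      also have "\<dots> = (K ^ L - 1) * (v mod K ^ i) + K ^ L * (K ^ (i + t * L) * m)"
        unfolding r(2) by (simp add: w algebra_simps)
      also have "K ^ L * (K ^ (i + t * L) * m) = K ^ (i + Suc t * L) * m"
        by (simp add: power_add algebra_simps)
      finally show ?thesis .
    qed
    ultimately show ?case by blast
  qed
  have "K ^ i * y + v mod K ^ i \<in> P"
    using fun_cong[OF f, of y] v(1) v_eq unfolding f_def j vj by (simp add: j[symmetric] vj)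
  then have "\<exists>r. K ^ (i + t * L) * y + r \<in> P
          \<and> (K ^ L - 1) * r + K ^ i * m = (K ^ L - 1) * (v mod K ^ i) + K ^ (i + t * L) * m" for t
    using pump[of t] by blast
  then show ?thesis
    using L y v_eq v_less unfolding N_def by blast
qed

lemma coprime_power_minus_one:
  fixes K :: nat
  assumes "K \<ge> 2" "L \<ge> 1"
  shows "coprime (K ^ L - 1) (K ^ i)"
proof -
  have "coprime (K ^ L - 1) (K ^ L)"
    using assms by (intro coprime_diff_one_left_nat) simp
  then have "coprime (K ^ L - 1) K"
    using assms(2) by (simp add: coprime_power_right_iff)
  then show ?thesis by simp
qed

text \<open>Pumping \<open>v\<close> yields elements \<open>\<alpha> * K ^ (t * L) + \<beta>\<close> that are products of a bounded number and of
  a divisor of a power of \<open>K\<close>. This forces \<open>\<beta> = 0\<close>, so all digits of \<open>v\<close> below the pumped ones are zero.\<close>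

lemma almost_smooth_kernel_finite:
  assumes K: "K \<ge> 2" and fin: "finite (kernel K P)"
    and smooth: "\<And>v. v \<in> P \<Longrightarrow> \<exists>v' h j. v = v' * h \<and> h dvd K ^ j \<and> v' \<le> N"
    and v: "v \<in> P"
  shows "\<exists>u i. u < K ^ (card (kernel K P) + 1) \<and> v = u * K ^ i"
proof (cases "v \<ge> K ^ card (kernel K P)")
  case False
  have "v < K ^ card (kernel K P)" using False by simp
  also have "\<dots> \<le> K ^ (card (kernel K P) + 1)" using K by (intro power_increasing) auto
  finally have "v < K ^ (card (kernel K P) + 1)" .
  then show ?thesis by (intro exI[of _ v] exI[of _ 0]) simp
next
  case True
  obtain i L m y where L: "L \<ge> 1" "y \<ge> 1" and v_eq: "v = K ^ (i + L) * y + (K ^ i * m + v mod K ^ i)"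
    and v_less: "v < K ^ (i + card (kernel K P) + 1)"
    and pump: "\<forall>t. \<exists>r. K ^ (i + t * L) * y + r \<in> P
          \<and> (K ^ L - 1) * r + K ^ i * m = (K ^ L - 1) * (v mod K ^ i) + K ^ (i + t * L) * m"
    using kernel_pump[OF K fin v True] by blast
  define a b where "a = K ^ i * m" and "b = (K ^ L - 1) * (v mod K ^ i)"
  have "a = b"
  proof (rule ccontr)
    assume "a \<noteq> b"
    \<comment> \<open>The absolute value of \<open>b - a\<close>, the constant term of
      \<open>(K ^ L - 1) * vt\<close>; one of the truncated differences is \<open>0\<close>.\<close>
    define \<beta> where "\<beta> = (a - b) + (b - a)"
    have \<beta>: "\<beta> > 0" using \<open>a \<noteq> b\<close> by (auto simp: \<beta>_def)
    \<comment> \<open>Large enough for both \<open>\<beta> < 2 ^ t\<close> and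
      \<open>N * \<beta> < vt\<close>.\<close>
    define t where "t = N * \<beta> + \<beta>"
    obtain r where r: "K ^ (i + t * L) * y + r \<in> P"
       "(K ^ L - 1) * r + a = b + K ^ (i + t * L) * m"
      using pump unfolding a_def b_def by blast
    define vt where "vt = K ^ (i + t * L) * y + r"
    obtain v' h j where h: "vt = v' * h" "h dvd K ^ j" "v' \<le> N"
      using smooth[OF r(1)] unfolding vt_def by blast
    define d where "d = gcd h (K ^ t)"
    have "K ^ t dvd K ^ (i + t * L)" using L(1) by (intro le_imp_power_dvd) (cases L; simp)
    then have dK: "d dvd K ^ (i + t * L) * x" for x
      unfolding d_def by (meson dvd_mult2 dvd_trans gcd_dvd2)
    have "d dvd vt" unfolding d_def h(1) by simp
    have "(K ^ L - 1) * vt + a = b + K ^ (i + t * L) * (m + (K ^ L - 1) * y)"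
      using r(2) by (simp add: vt_def algebra_simps)
    moreover have "d dvd (K ^ L - 1) * vt" using \<open>d dvd vt\<close> by simp
    ultimately have "d dvd a - b" "d dvd b - a"
    proof -
      assume eq: "(K ^ L - 1) * vt + a = b + K ^ (i + t * L) * (m + (K ^ L - 1) * y)"
        and dv: "d dvd (K ^ L - 1) * vt"
      show "d dvd a - b"
      proof (cases "b \<le> a")
        case True
        then have "K ^ (i + t * L) * (m + (K ^ L - 1) * y) = (K ^ L - 1) * vt + (a - b)" using eq by linarith
        then show ?thesis using dK dv by (metis dvd_add_right_iff)
      qed simp
      show "d dvd b - a"
      proof (cases "a \<le> b")
        case True
        then have "(K ^ L - 1) * vt = K ^ (i + t * L) * (m + (K ^ L - 1) * y) + (b - a)" using eq by linarith
        then show ?thesis using dK dv by (metis dvd_add_right_iff)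
      qed simp
    qed
    then have "d dvd \<beta>" unfolding \<beta>_def by simp
    then have "d \<le> \<beta>" using \<beta> by (rule dvd_imp_le)
    also have "\<beta> \<le> t" by (simp add: t_def)
    also have "t < 2 ^ t" by (rule less_exp)
    finally have "h dvd K ^ t"
      using dvd_power_or_gcd_large[OF h(2), of t] unfolding d_def by linarith
    then have "d = h" unfolding d_def by (simp add: gcd_proj1_if_dvd)
    then have "vt \<le> N * \<beta>" using h \<open>d \<le> \<beta>\<close> by (simp add: mult_le_mono)
    moreover have "t < vt"
    proof -
      have "t < 2 ^ t" by (rule less_exp)
      also have "\<dots> \<le> K ^ t" using K by (intro power_mono) auto
      also have "\<dots> \<le> K ^ (i + t * L)" using K L(1) by (intro power_increasing) (cases L; simp)+
      also have "\<dots> \<le> K ^ (i + t * L) * y" using L(2) by simp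
      also have "\<dots> \<le> vt" by (simp add: vt_def)
      finally show ?thesis .
    qed
    ultimately show False by (simp add: t_def)
  qed
  then have "K ^ i dvd (K ^ L - 1) * (v mod K ^ i)" unfolding a_def b_def by (metis dvd_triv_left)
  then have "K ^ i dvd v mod K ^ i"
    using coprime_power_minus_one[OF K L(1), of i] by (simp add: coprime_commute coprime_dvd_mult_right_iff)
  then have "v mod K ^ i = 0" by (simp add: dvd_eq_mod_eq_0)
  then have v_div: "v = v div K ^ i * K ^ i" by (metis add.right_neutral div_mult_mod_eq)
  have "v div K ^ i < K ^ (card (kernel K P) + 1)"
    using v_less by (intro less_mult_imp_div_less) (simp add: power_add algebra_simps)
  then show ?thesis using v_div by blast
qed

section \<open>Recovering powers by a congruence\<close>

lemma power_mod_minus_one: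
  fixes M :: nat
  assumes "M \<ge> 1"
  shows "(M ^ t * x) mod (M - 1) = x mod (M - 1)"
proof -
  have "(M * y) mod (M - 1) = y mod (M - 1)" for y
  proof -
    have "M * y = y + (M - 1) * y" using assms by (cases M) auto
    then show ?thesis by simp
  qed
  then show ?thesis by (induction t) (auto simp: mult.assoc)
qed

text \<open>With \<open>M = K ^ m\<close> and \<open>g * z = u * K ^ i\<close>, the congruence gives
  \<open>u * K ^ i' = g\<close> modulo \<open>M - 1\<close>, where \<open>i' = i mod m\<close>.
  Multiplication by \<open>K ^ i'\<close> modulo \<open>M - 1\<close> rotates \<open>m\<close>
  digits, and \<open>u\<close> and \<open>g\<close> have at most \<open>b\<close> digits with
  \<open>2 * b \<le> m\<close>. Without wraparound the congruence is an equation. With wraparound,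
  the digits \<open>u0\<close> that stay below \<open>M\<close> would contribute more than
  \<open>g\<close>, so \<open>u0 = 0\<close> and the wrapped part \<open>u1\<close> is
  \<open>g\<close>.\<close>

lemma powers_eq_congruence:
  fixes K :: nat
  assumes K: "K \<ge> 2" and g: "g \<ge> 1" "\<And>i. K ^ i * g \<in> P" and P: "\<And>v. v \<in> P \<Longrightarrow> \<exists>u i. u < B \<and> v = u * K ^ i"
    and b: "B + g + 2 \<le> K ^ b" and m: "2 * b \<le> m"
  shows "g * z \<in> P \<and> z mod (K ^ m - 1) = 1 mod (K ^ m - 1) \<longleftrightarrow> z \<in> range ((^) (K ^ m))"
proof
  define M where "M = K ^ m"
  assume "g * z \<in> P \<and> z mod (K ^ m - 1) = 1 mod (K ^ m - 1)"
  then have z: "g * z \<in> P" "z mod (M - 1) = 1 mod (M - 1)" by (auto simp: M_def)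
  obtain u i where u: "u < B" "g * z = u * K ^ i" using P[OF z(1)] by blast
  define i' t where "i' = i mod m" and "t = i div m"
  have M1: "M \<ge> 1" using K by (simp add: M_def)
  have "b \<ge> 1" using b g by (cases b) auto
  then have "m > 0" using m by simp
  then have i': "i' < m" "i = m * t + i'" by (auto simp: i'_def t_def)
  then have gz: "g * z = M ^ t * (u * K ^ i')"
    using u(2) by (simp add: M_def power_add power_mult)
  have "K ^ b \<le> M" using K m unfolding M_def by (intro power_increasing) auto
  then have gM: "g < M - 1" using b by linarith
  have "(u * K ^ i') mod (M - 1) = (g * z) mod (M - 1)"
    unfolding gz by (rule power_mod_minus_one[OF M1, symmetric])
  also have "\<dots> = (g * (z mod (M - 1))) mod (M - 1)" by (simp add: mod_mult_right_eq)
  also have "\<dots> = g mod (M - 1)" unfolding z(2) by (simp add: mod_mult_right_eq)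
  also have "\<dots> = g" using gM by simp
  finally have cong: "(u * K ^ i') mod (M - 1) = g" .
  show "z \<in> range ((^) (K ^ m))"
  proof (cases "i' + b \<le> m")
    case True
    have "u + 2 \<le> K ^ b" using u(1) b by linarith
    then have "(u + 2) * K ^ i' \<le> K ^ b * K ^ i'" by (rule mult_le_mono1)
    also have "\<dots> \<le> M" unfolding M_def power_add[symmetric] using True K by (intro power_increasing) auto
    finally have "u * K ^ i' + 2 * K ^ i' \<le> M" by (simp add: algebra_simps)
    moreover have "K ^ i' \<ge> 1" using K by simp
    ultimately have "u * K ^ i' < M - 1" by linarith
    then have "u * K ^ i' = g" using cong by simp
    then have "g * z = g * M ^ t" unfolding gz by (simp only: mult.commute)
    then have "z = M ^ t" using g(1) by simp
    then show ?thesis by (simp add: M_def)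
  next
    case False
    define b' where "b' = m - i'"
    define u1 u0 where "u1 = u div K ^ b'" and "u0 = u mod K ^ b'"
    have M: "M = K ^ b' * K ^ i'" using i'(1) by (simp add: M_def b'_def flip: power_add)
    have u_eq: "u = K ^ b' * u1 + u0" by (simp add: u1_def u0_def)
    have "u0 < K ^ b'" using K by (simp add: u0_def)
    have "K ^ b \<le> K ^ i'" using False m K by (intro power_increasing) auto
    then have Ki': "B + g + 2 \<le> K ^ i'" using b by linarith
    have "u1 \<le> u" by (simp add: u1_def)
    have "(u0 + 1) * K ^ i' \<le> M" unfolding M using \<open>u0 < K ^ b'\<close> by (intro mult_le_mono1) simp
    then have "u0 * K ^ i' + K ^ i' \<le> M" by (simp add: algebra_simps)
    then have small: "u1 + u0 * K ^ i' < M - 1" using Ki' u(1) \<open>u1 \<le> u\<close> by linarith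
    have eq: "u * K ^ i' = M * u1 + u0 * K ^ i'"
      unfolding M by (subst u_eq) (simp add: algebra_simps)
    have "(u * K ^ i') mod (M - 1) = (u1 + u0 * K ^ i') mod (M - 1)"
      unfolding eq using power_mod_minus_one[OF M1, of 1 u1] by (metis mod_add_left_eq power_one_right)
    then have sum: "u1 + u0 * K ^ i' = g" using cong small by simp
    have "u0 = 0"
    proof (rule ccontr)
      assume "u0 \<noteq> 0"
      then have "K ^ i' \<le> u0 * K ^ i'" by simp
      then show False using sum Ki' by linarith
    qed
    then have "g * z = g * M ^ Suc t" using sum eq gz by (simp add: mult.commute mult.left_commute)
    then have "z = M ^ Suc t" using g(1) by (simp del: power_Suc)
    then show ?thesis by (metis M_def rangeI)
  qed
next
  assume "z \<in> range ((^) (K ^ m))"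
  then obtain t where "z = (K ^ m) ^ t" by blast
  then show "g * z \<in> P \<and> z mod (K ^ m - 1) = 1 mod (K ^ m - 1)"
    using g(2)[of "m * t"] power_mod_minus_one[of "K ^ m" t 1] K by (simp add: power_mult mult.commute)
qed

text \<open>The relation defined here is the one that Buechi arithmetic to base \<open>K ^ m\<close> adds to addition.\<close>

lemma definable_rel_power_dvd:
  fixes R :: "nat \<Rightarrow> nat \<Rightarrow> bool"
  assumes K: "K \<ge> 2" and fin: "finite (kernel K X)"
    and definable_rel: "\<And>t u. definable_fun X t \<Longrightarrow> definable_fun X u \<Longrightarrow> definable_rel X (\<lambda>e. R (t e) (u e))"
    and R: "\<And>v x. R v x \<Longrightarrow> 0 < v \<and> v dvd x \<and> (\<forall>y. v dvd y \<longrightarrow> R v y)"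
    and g: "g \<ge> 1" "\<And>i. R (K ^ i * g) (K ^ i * g)"
  shows "\<exists>m0. \<forall>m\<ge>m0. \<forall>t u. definable_fun X t \<longrightarrow> definable_fun X u \<longrightarrow>
    definable_rel X (\<lambda>e. t e \<in> range ((^) (K ^ m)) \<and> t e dvd u e)"
proof -
  let ?C = "{\<lambda>x y. R (K ^ j * x + r) (K ^ j * y + r') | j r r'. r < K ^ j \<and> r' < K ^ j}"
  define P where "P = {v. R v v}"
  have RP: "R v x \<longleftrightarrow> v \<in> P \<and> v dvd x" for v x
    unfolding P_def mem_Collect_eq using R[of v x] R[of v v] dvd_refl[of v] by metis
  have finC: "finite ?C"
    using K by (intro finite_kernel_rel[OF fin] definable_rel definable_fun_var) simp
  \<comment> \<open>Every number divides \<open>0\<close>, so \<open>R v 0\<close> expresses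
    \<open>v \<in> P\<close>.\<close>
  have "kernel K P \<subseteq> (\<lambda>f a. f a 0) ` ?C"
  proof
    fix f
    assume "f \<in> kernel K P"
    then obtain j r where f: "f = (\<lambda>a. K ^ j * a + r \<in> P)" "r < K ^ j" by (auto simp: kernel_def)
    have "0 < K ^ j" using K by simp
    then have "(\<lambda>x y. R (K ^ j * x + r) (K ^ j * y + 0)) \<in> ?C" using f(2) by blast
    then show "f \<in> (\<lambda>f a. f a 0) ` ?C"
      by (rule rev_image_eqI) (simp add: f(1) RP)
  qed
  then have finP: "finite (kernel K P)" by (rule finite_subset) (use finC in auto)
  have smooth: "\<exists>v' h j. v = v' * h \<and> h dvd K ^ j \<and> v' \<le> card ?C" if "v \<in> P" for v
    using that R by (intro divisors_almost_smooth[OF K finC]) (auto simp: RP)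
  define B where "B = K ^ (card (kernel K P) + 1)"
  have B: "\<exists>u i. u < B \<and> v = u * K ^ i" if "v \<in> P" for v
    unfolding B_def using almost_smooth_kernel_finite[OF K finP smooth that] .
  define b where "b = B + g + 2"
  have b: "B + g + 2 \<le> K ^ b"
    using less_imp_le[OF power_gt_expt[of K b]] K unfolding b_def by simp
  have "definable_rel X (\<lambda>e. t e \<in> range ((^) (K ^ m)) \<and> t e dvd u e)"
    if m: "m \<ge> 2 * b" and tu: "definable_fun X t" "definable_fun X u" for m t u
  proof -
    have gP: "K ^ i * g \<in> P" for i using g(2) by (simp add: P_def)
    have "2 ^ 1 \<le> K ^ 1" using K by simp
    also have "\<dots> \<le> K ^ m" using m K by (intro power_increasing) (auto simp: b_def)
    finally have M: "K ^ m - 1 > 0" by simp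
    have "definable_rel X (\<lambda>e. R (g * t e) (g * u e) \<and> t e mod (K ^ m - 1) = 1 mod (K ^ m - 1))"
      by (intro definable_intros definable_rel definable_rel_mod tu M)
    moreover have "R (g * z) (g * x) \<and> z mod (K ^ m - 1) = 1 mod (K ^ m - 1)
        \<longleftrightarrow> z \<in> range ((^) (K ^ m)) \<and> z dvd x" for z x
    proof -
      have "R (g * z) (g * x) \<longleftrightarrow> g * z \<in> P \<and> z dvd x"
        unfolding RP using g(1) by simp
      then show ?thesis using powers_eq_congruence[OF K g(1) gP B b m, of z] by blast
    qed
    ultimately show ?thesis by (simp only:)
  qed
  then show ?thesis by blast
qed

section \<open>Definability of all automatic sets\<close>

text \<open>The position is given by the power \<open>z\<close>. Apart from addition and order, only
  the relation of being a power of \<open>K\<close> that divides a number is used, as this is what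
  has been made definable.\<close>

definition digit_at :: "nat \<Rightarrow> nat \<Rightarrow> nat \<Rightarrow> nat \<Rightarrow> bool" where
  "digit_at K z y i \<longleftrightarrow> (\<exists>u b. y = u + (i * z + b) \<and> b < z \<and> K * z \<in> range ((^) K) \<and> K * z dvd u)"

lemma digit_at_power:
  assumes "K \<ge> 2" "i < K"
  shows "digit_at K (K ^ j) y i \<longleftrightarrow> y div K ^ j mod K = i"
proof -
  have pos: "K ^ j > 0" using assms(1) by simp
  show ?thesis
  proof
    assume "digit_at K (K ^ j) y i"
    then obtain u b where *: "y = u + (i * K ^ j + b)" "b < K ^ j" "K * K ^ j dvd u"
      unfolding digit_at_def by blast
    then obtain w where "u = K * K ^ j * w" by blast
    then have "y = b + (K * w + i) * K ^ j" using *(1) by (simp add: algebra_simps)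
    then have "y div K ^ j = K * w + i" using pos *(2) by simp
    then show "y div K ^ j mod K = i" using assms(2) by simp
  next
    assume *: "y div K ^ j mod K = i"
    define w where "w = y div K ^ j div K"
    have "y = y div K ^ j * K ^ j + y mod K ^ j" by (rule div_mult_mod_eq[symmetric])
    also have "y div K ^ j = w * K + i" unfolding w_def *[symmetric] by simp
    finally have "y = K * K ^ j * w + (i * K ^ j + y mod K ^ j)" by (simp add: algebra_simps)
    moreover have "K * K ^ j \<in> range ((^) K)" using rangeI[of "(^) K" "Suc j"] by simp
    moreover have "y mod K ^ j < K ^ j" using pos by simp
    ultimately show "digit_at K (K ^ j) y i" unfolding digit_at_def by (metis dvd_triv_left)
  qed
qed

lemma ex_digits:
  fixes K :: nat
  assumes "\<And>j. d j < K"
  shows "\<exists>y. \<forall>j<n. y div K ^ j mod K = d j"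
  using assms
proof (induction n arbitrary: d)
  case (Suc n)
  have "\<exists>y. \<forall>j<n. y div K ^ j mod K = d (Suc j)"
    by (rule Suc.IH) (rule Suc.prems)
  then obtain y where y: "\<And>j. j < n \<Longrightarrow> y div K ^ j mod K = d (Suc j)" by blast
  have "(K * y + d 0) div K ^ j mod K = d j" if "j < Suc n" for j
  proof (cases j)
    case 0
    then show ?thesis using Suc.prems[of 0] by simp
  next
    case (Suc i)
    have "(K * y + d 0) div K ^ j = y div K ^ i"
      using Suc.prems[of 0] by (simp add: Suc div_mult2_eq)
    then show ?thesis using y[of i] Suc that by simp
  qed
  then show ?case by blast
qed simp

text \<open>The run of an automaton on the digits of \<open>x\<close>, least significant first, is coded by a number
  \<open>y\<close> whose digits are the states. The states are the elements of the kernel of \<open>Y\<close>.\<close>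

lemma definable_rel_kernel_finite_set:
  assumes K: "K \<ge> 2" and fin: "finite (kernel K Y)" and card: "card (kernel K Y) \<le> K"
    and dvd: "\<And>t u. definable_fun Z t \<Longrightarrow> definable_fun Z u \<Longrightarrow> definable_rel Z (\<lambda>e. t e \<in> range ((^) K) \<and> t e dvd u e)"
  shows "definable_rel Z (\<lambda>e. e 0 \<in> Y)"
proof -
  obtain code where code: "bij_betw code (kernel K Y) {..<card (kernel K Y)}"
    using fin by (metis atLeast0LessThan ex_bij_betw_finite_nat)
  define dec where "dec = inv_into (kernel K Y) code"
  have code_less: "code h < K" if "h \<in> kernel K Y" for h
    using bij_betwE[OF code] that card by fastforce
  have dec: "dec (code h) = h" if "h \<in> kernel K Y" for h
    unfolding dec_def using that code by (simp add: bij_betw_def)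
  define st where "st j x = (\<lambda>n. K ^ j * n + x mod K ^ j \<in> Y)" for j x
  have st: "st j x \<in> kernel K Y" for j x
    unfolding st_def kernel_def using K by (intro CollectI exI[of _ j] exI[of _ "x mod K ^ j"]) simp
  define step where "step h c = (\<lambda>n. h (K * n + c))" for h :: "nat \<Rightarrow> bool" and c
  have step: "step (st j x) (x div K ^ j mod K) = st (Suc j) x" for j x
  proof -
    have "x mod K ^ Suc j = K ^ j * (x div K ^ j mod K) + x mod K ^ j"
      by (simp only: power_Suc2 mod_mult2_eq)
    then show ?thesis by (simp add: step_def st_def algebra_simps)
  qed
  define trans where "trans i c = code (step (dec i) c)" for i c
  \<comment> \<open>The run stops at a power \<open>z0\<close> beyond \<open>x\<close>. What is left
    of \<open>x\<close> there is \<open>0\<close>, so the last state accepts if it holds at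
    \<open>0\<close>. All states fit into digits as the kernel has at most \<open>K\<close>
    elements.\<close>
  define \<Phi> where "\<Phi> x y z0 \<longleftrightarrow> z0 \<in> range ((^) K) \<and> x < z0 \<and> digit_at K 1 y (code (st 0 0)) \<and>
     (\<forall>z. z \<in> range ((^) K) \<and> z < z0 \<longrightarrow> (\<forall>i\<in>{..<K}. \<forall>c\<in>{..<K}.
        digit_at K z y i \<and> digit_at K z x c \<longrightarrow> digit_at K (K * z) y (trans i c))) \<and>
     (\<forall>i\<in>{..<K}. digit_at K z0 y i \<longrightarrow> dec i 0)" for x y z0
  have st0: "st 0 x = st 0 0" for x by (simp add: st_def)
  have "x \<in> Y \<longleftrightarrow> (\<exists>y z0. \<Phi> x y z0)" for x
  proof
    assume x: "x \<in> Y"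
    obtain y where y: "\<And>j. j < Suc x \<Longrightarrow> y div K ^ j mod K = code (st j x)"
      using ex_digits[of "\<lambda>j. code (st j x)" K "Suc x"] code_less[OF st] by blast
    have lt: "x < K ^ x" using K by (simp add: power_gt_expt)
    have "\<Phi> x y (K ^ x)"
      unfolding \<Phi>_def
    proof (intro conjI allI impI ballI)
      show "K ^ x \<in> range ((^) K)" by simp
      show "x < K ^ x" by (rule lt)
      show "digit_at K 1 y (code (st 0 0))"
        using digit_at_power[OF K code_less[OF st], of 0 y 0 0] y[of 0] st0[of x] by simp
    next
      fix z i c
      assume z: "z \<in> range ((^) K) \<and> z < K ^ x" and ic: "i \<in> {..<K}" "c \<in> {..<K}"
        and d: "digit_at K z y i \<and> digit_at K z x c"
      obtain j where j: "z = K ^ j" using z by blast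
      then have "j < x" using z K by (simp add: power_less_imp_less_exp)
      have "i = code (st j x)" "c = x div K ^ j mod K"
        using d ic y[of j] \<open>j < x\<close> digit_at_power[OF K] unfolding j by auto
      then have "trans i c = code (st (Suc j) x)"
        by (simp add: trans_def dec[OF st] step)
      then show "digit_at K (K * z) y (trans i c)"
        using digit_at_power[OF K code_less[OF st], of "Suc j" y "Suc j" x] y[of "Suc j"] \<open>j < x\<close>
        by (simp add: j)
    next
      fix i
      assume i: "i \<in> {..<K}" "digit_at K (K ^ x) y i"
      then have "i = code (st x x)" using digit_at_power[OF K, of i x y] y[of x] by simp
      then show "dec i 0" using x lt by (simp add: dec[OF st]) (simp add: st_def)
    qed
    then show "\<exists>y z0. \<Phi> x y z0" by blast
  next
    assume "\<exists>y z0. \<Phi> x y z0"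
    then obtain y J where \<Phi>: "\<Phi> x y (K ^ J)" unfolding \<Phi>_def by blast
    have run: "digit_at K (K ^ j) y (code (st j x))" if "j \<le> J" for j
      using that
    proof (induction j)
      case 0
      show ?case using \<Phi> st0[of x] unfolding \<Phi>_def by simp
    next
      case (Suc j)
      have "K ^ j \<in> range ((^) K) \<and> K ^ j < K ^ J" using Suc.prems K by simp
      moreover have "digit_at K (K ^ j) x (x div K ^ j mod K)"
        using digit_at_power[OF K, of "x div K ^ j mod K" j x] K by simp
      moreover have "digit_at K (K ^ j) y (code (st j x))" using Suc by simp
      moreover have "code (st j x) \<in> {..<K}" "x div K ^ j mod K \<in> {..<K}"
        using code_less[OF st] K by auto
      ultimately have "digit_at K (K * K ^ j) y (trans (code (st j x)) (x div K ^ j mod K))"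
        using \<Phi> unfolding \<Phi>_def by blast
      then show ?case by (simp add: trans_def dec[OF st] step)
    qed
    have "code (st J x) \<in> {..<K}" using code_less[OF st] by simp
    then have "dec (code (st J x)) 0" using \<Phi> run[of J] unfolding \<Phi>_def by blast
    then have "st J x 0" by (simp add: dec[OF st])
    moreover have "x < K ^ J" using \<Phi> unfolding \<Phi>_def by blast
    ultimately show "x \<in> Y" by (simp add: st_def)
  qed
  moreover have "definable_rel Z (\<lambda>e. \<exists>y z0. \<Phi> (e 0) y z0)"
  proof -
    have pw: "definable_rel Z (\<lambda>e. t e \<in> range ((^) K))" if "definable_fun Z t" for t
      using dvd[OF that that] by simp
    have dig: "definable_rel Z (\<lambda>e. digit_at K (t e) (u e) i)" if "definable_fun Z t" "definable_fun Z u" for t u i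
    proof -
      note ren = that[THEN definable_fun_ren]
      show ?thesis unfolding digit_at_def by (intro definable_intros dvd ren)
    qed
    show ?thesis
      unfolding \<Phi>_def by (intro definable_intros definable_rel_ball_finite definable_rel_const pw dig finite_lessThan)
  qed
  ultimately show ?thesis by (simp only:)
qed

text \<open>As \<open>k ^ d\<close> is \<open>1\<close> modulo \<open>k ^ d - 1\<close>, only
  \<open>k ^ i\<close> with \<open>i = n mod d\<close> remains of \<open>k ^ n\<close>; for
  \<open>i > 0\<close> it lies strictly between \<open>1\<close> and
  \<open>k ^ d - 1\<close>.\<close>

lemma powers_of_power_iff:
  fixes k :: nat
  assumes "k \<ge> 2" "d \<ge> 1"
  shows "z \<in> range ((^) k) \<and> z mod (k ^ d - 1) = 1 mod (k ^ d - 1) \<longleftrightarrow> z \<in> range ((^) (k ^ d))"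
proof
  have K1: "k ^ d \<ge> 1" using assms(1) by simp
  assume z: "z \<in> range ((^) k) \<and> z mod (k ^ d - 1) = 1 mod (k ^ d - 1)"
  then obtain n where n: "z = k ^ n" by blast
  define i where "i = n mod d"
  have i: "i < d" using assms(2) by (simp add: i_def)
  have "n = d * (n div d) + i" by (simp add: i_def)
  then have z_eq: "z = (k ^ d) ^ (n div d) * k ^ i"
    unfolding n by (metis power_add power_mult)
  have cong: "k ^ i mod (k ^ d - 1) = 1 mod (k ^ d - 1)"
    using z power_mod_minus_one[OF K1, of "n div d" "k ^ i"] unfolding z_eq by simp
  have "i = 0"
  proof (rule ccontr)
    assume "i \<noteq> 0"
    then have "k ^ i \<ge> 2" using assms(1) power_increasing[of 1 i k] \<open>i \<noteq> 0\<close> by simp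
    have "2 * k ^ i \<le> k * k ^ i" using assms(1) by (rule mult_le_mono1)
    also have "\<dots> \<le> k ^ d" using i assms(1) unfolding power_Suc[symmetric] by (intro power_increasing) auto
    finally have lt: "k ^ i < k ^ d - 1" using \<open>k ^ i \<ge> 2\<close> by linarith
    then have "1 < k ^ d - 1" using \<open>k ^ i \<ge> 2\<close> by linarith
    with lt have "k ^ i = 1" using cong by (simp only: mod_less)
    then show False using \<open>k ^ i \<ge> 2\<close> by linarith
  qed
  then show "z \<in> range ((^) (k ^ d))" using z_eq by simp
next
  assume "z \<in> range ((^) (k ^ d))"
  then obtain t where t: "z = (k ^ d) ^ t" by blast
  then show "z \<in> range ((^) k) \<and> z mod (k ^ d - 1) = 1 mod (k ^ d - 1)"
    using power_mod_minus_one[of "k ^ d" t 1] assms(1) by (simp flip: power_mult)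
qed

section \<open>The dichotomy between repeated and unique returns of letters\<close>

theorem theorem1p1:
  fixes k :: nat and X :: "nat set"
  assumes "k \<ge> 2" and "k_automatic k X" and "\<not> eventually_periodic X"
  shows "(\<forall>Y. k_automatic k Y \<longrightarrow> definable_in X Y) \<or> definable_in (range (\<lambda>n::nat. k ^ n)) X"
proof -
  have finX: "finite (kernel k X)" using finite_kernel_if_k_automatic assms(1,2) .
  obtain d0 where d0: "d0 \<ge> 1" "block_coding (\<lambda>a. {c. c < k ^ d0 \<and> k ^ d0 * a + c \<in> X}) (k ^ d0)"
    using ex_block_coding[OF assms(1) finX] by blast
  define s where "s a = {c. c < k ^ d0 \<and> k ^ d0 * a + c \<in> X}" for a
  interpret S0: block_coding s "k ^ d0" using d0(2) unfolding s_def .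
  obtain d1 where d1: "d1 \<ge> 1"
    "\<forall>q\<in>range s. (\<exists>n\<ge>1. \<exists>c<((k ^ d0) ^ d1) ^ n. blk s ((k ^ d0) ^ d1) n q c = q)
      \<longrightarrow> (\<exists>c<(k ^ d0) ^ d1. blk s ((k ^ d0) ^ d1) 1 q c = q)"
    "\<forall>q\<in>range s. blk s ((k ^ d0) ^ d1) 1 (blk s ((k ^ d0) ^ d1) 1 q 0) 0 = blk s ((k ^ d0) ^ d1) 1 q 0"
    using S0.ex_normalized_power by (elim exE conjE) (rule that)
  define d K where "d = d0 * d1" and "K = k ^ d"
  have K_eq: "(k ^ d0) ^ d1 = K" by (simp add: K_def d_def power_mult)
  have norm: "\<exists>c<K. blk s K 1 q c = q"
    if "q \<in> range s" "n \<ge> 1" "c < K ^ n" "blk s K n q c = q" for q n c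
    using d1(2) that unfolding K_eq by blast
  have first: "blk s K 1 (blk s K 1 q 0) 0 = blk s K 1 q 0" if "q \<in> range s" for q
    using d1(3) that unfolding K_eq by blast
  have d: "d \<ge> 1" using d0(1) d1(1) by (simp add: d_def)
  interpret S: block_coding s K
    using S0.block_coding_power[OF d1(1)] unfolding K_eq .
  show ?thesis
  proof (cases "\<exists>q n c c'. q \<in> range s \<and> \<not> uniformly_periodic s K q \<and> c < c' \<and> c' < K ^ n
      \<and> blk s K n q c = q \<and> blk s K n q c' = q")
    case True
    then obtain q n c c' where q: "q \<in> range s" "\<not> uniformly_periodic s K q"
      and c: "c < c'" "c' < K ^ n" "blk s K n q c = q" "blk s K n q c' = q" by blast
    have n: "n \<ge> 1" using c(1,2) by (cases n) auto
    \<comment> \<open>Over the base \<open>K ^ n\<close>, both occurrences lie in the first image of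
      \<open>q\<close>.\<close>
    interpret Sn: block_coding s "K ^ n" using S.block_coding_power[OF n] .
    have "c < K ^ n" using c by simp
    obtain c0 where c0: "c0 < K" "blk s K 1 q c0 = q"
      using norm[OF q(1) n \<open>c < K ^ n\<close> c(3)] by blast
    \<comment> \<open>A violation of a period persists at all higher levels, among them multiples of
      \<open>n\<close>.\<close>
    have "\<not> uniformly_periodic s (K ^ n) q"
    proof
      assume "uniformly_periodic s (K ^ n) q"
      then obtain p where p: "p \<ge> 1"
        "\<And>l i. i + p < K ^ (n * l) \<Longrightarrow> blk s K (n * l) q (i + p) = blk s K (n * l) q i"
        unfolding uniformly_periodic_def blk_power by (auto simp: power_mult)
      obtain n0 where "\<And>l. l \<ge> n0 \<Longrightarrow> \<exists>i. i + p < K ^ l \<and> blk s K l q (i + p) \<noteq> blk s K l q i"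
        using S.not_uniformly_periodic_large[OF q(1) c0 q(2) p(1)] by blast
      moreover have "n * n0 \<ge> n0" using n by simp
      ultimately show False using p(2) by blast
    qed
    then obtain J g where g: "g \<ge> 1" "\<And>i. occ_dvd s J ((K ^ n) ^ i * g) ((K ^ n) ^ i * g)"
      using Sn.ex_occ_dvd[OF q(1) c(1,2)] c(3,4) by (auto simp: blk_power)
    have sX: "definable_rel X (\<lambda>e. s (t e) = s (u e))" if "definable_fun X t" "definable_fun X u" for t u
    proof -
      have "definable_rel X (\<lambda>e. \<forall>c\<in>{..<k ^ d0}. k ^ d0 * t e + c \<in> X \<longleftrightarrow> k ^ d0 * u e + c \<in> X)"
        by (intro definable_rel_ball_finite definable_intros definable_rel_mem that finite_lessThan)
      moreover have "s a = s b \<longleftrightarrow> (\<forall>c\<in>{..<k ^ d0}. k ^ d0 * a + c \<in> X \<longleftrightarrow> k ^ d0 * b + c \<in> X)" for a b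
        unfolding s_def by auto
      ultimately show ?thesis by (simp only:)
    qed
    have Kn: "K ^ n = k ^ (d * n)" by (simp add: K_def power_mult)
    have finKn: "finite (kernel (K ^ n) X)"
      unfolding Kn using finX kernel_power by (rule rev_finite_subset)
    obtain m0 where m0: "\<And>m t u. m \<ge> m0 \<Longrightarrow> definable_fun X t \<Longrightarrow> definable_fun X u
        \<Longrightarrow> definable_rel X (\<lambda>e. t e \<in> range ((^) ((K ^ n) ^ m)) \<and> t e dvd u e)"
      using definable_rel_power_dvd[OF Sn.base finKn definable_rel_occ_dvd[OF sX] occ_dvd_imp g] by blast
    have "definable_in X Y" if "k_automatic k Y" for Y
    proof (rule definable_in_if_definable_rel)
      have finY: "finite (kernel k Y)" using finite_kernel_if_k_automatic[OF assms(1) that] .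
      \<comment> \<open>Beyond \<open>m0\<close>, positive, and so large that the kernel of
        \<open>Y\<close> has at most as many elements as there are digits in base
        \<open>(K ^ n) ^ m\<close>.\<close>
      define m where "m = m0 + card (kernel k Y) + 1"
      have KY: "(K ^ n) ^ m = k ^ (d * n * m)" by (simp add: K_def power_mult)
      have sub: "kernel ((K ^ n) ^ m) Y \<subseteq> kernel k Y" unfolding KY by (rule kernel_power)
      show "definable_rel X (\<lambda>e. e 0 \<in> Y)"
      proof (rule definable_rel_kernel_finite_set)
        show "2 \<le> (K ^ n) ^ m"
          using Sn.block_coding_power[of m] block_coding.base by (metis m_def le_add2)
        show "finite (kernel ((K ^ n) ^ m) Y)" using sub finY by (rule finite_subset)
        have "card (kernel ((K ^ n) ^ m) Y) \<le> card (kernel k Y)" by (rule card_mono[OF finY sub])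
        also have "\<dots> \<le> m" by (simp add: m_def)
        also have "m \<le> (K ^ n) ^ m" using Sn.base by (intro less_imp_le power_gt_expt) simp
        finally show "card (kernel ((K ^ n) ^ m) Y) \<le> (K ^ n) ^ m" .
        show "definable_rel X (\<lambda>e. t e \<in> range ((^) ((K ^ n) ^ m)) \<and> t e dvd u e)" if "definable_fun X t" "definable_fun X u" for t u
          by (rule m0[OF _ that]) (simp add: m_def)
      qed
    qed
    then show ?thesis by blast
  next
    case False
    have unique: "c = c'" if "q \<in> range s" "\<not> uniformly_periodic s K q" "c < K ^ n" "c' < K ^ n"
      "blk s K n q c = q" "blk s K n q c' = q" for q n c c'
      using False that by (metis linorder_neqE_nat)
    let ?Z = "range (\<lambda>n::nat. k ^ n)"
    have pw: "definable_rel ?Z (\<lambda>e. t e \<in> range ((^) K))" if "definable_fun ?Z t" for t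
    proof -
      have "K - 1 > 0" using S.base by simp
      then have "definable_rel ?Z (\<lambda>e. t e \<in> ?Z \<and> t e mod (K - 1) = 1 mod (K - 1))"
        by (intro definable_rel_conj definable_rel_mem definable_rel_mod that)
      then show ?thesis
        by (rule definable_rel_cong) (simp only: K_def powers_of_power_iff[OF assms(1) d])
    qed
    note rel = S.definable_rel_block_rel[OF pw norm first unique]
    \<comment> \<open>The \<open>n\<close>-th image of \<open>s 0\<close> is the prefix of
      \<open>s\<close> of length \<open>K ^ n\<close>, so every level with \<open>y < K ^ n\<close>
      yields the letter \<open>s y\<close>.\<close>
    have X_iff: "x \<in> X \<longleftrightarrow> (\<exists>y z. \<exists>c\<in>{..<k ^ d0}. \<exists>p\<in>{p \<in> range s. c \<in> p}.
        x = k ^ d0 * y + c \<and> block_rel s K (s 0) p z y)" for x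
    proof
      assume "x \<in> X"
      define y c where "y = x div k ^ d0" and "c = x mod k ^ d0"
      have x: "x = k ^ d0 * y + c" "c < k ^ d0"
        using assms(1) by (simp_all add: y_def c_def)
      have "y < K ^ y" using S.base by (simp add: power_gt_expt)
      then have "block_rel s K (s 0) (s y) (K ^ y) y"
        unfolding block_rel_def using S.blk[of y y 0] by auto
      moreover have "c \<in> s y" using x \<open>x \<in> X\<close> by (simp add: s_def)
      ultimately show "\<exists>y z. \<exists>c\<in>{..<k ^ d0}. \<exists>p\<in>{p \<in> range s. c \<in> p}.
        x = k ^ d0 * y + c \<and> block_rel s K (s 0) p z y" using x by blast
    next
      assume "\<exists>y z. \<exists>c\<in>{..<k ^ d0}. \<exists>p\<in>{p \<in> range s. c \<in> p}.
        x = k ^ d0 * y + c \<and> block_rel s K (s 0) p z y"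
      then obtain y c n where x: "x = k ^ d0 * y + c" "c \<in> blk s K n (s 0) y" "y < K ^ n"
        unfolding block_rel_def by blast
      then have "c \<in> s y" using S.blk[of y n 0] by simp
      then show "x \<in> X" using x(1) by (simp add: s_def)
    qed
    have "definable_rel ?Z (\<lambda>e. \<exists>y z. \<exists>c\<in>{..<k ^ d0}. \<exists>p\<in>{p \<in> range s. c \<in> p}.
        e 0 = k ^ d0 * y + c \<and> block_rel s K (s 0) p z y)"
      by (intro definable_intros definable_rel_bex_finite rel) (use S.finite_range in auto)
    then have "definable_rel ?Z (\<lambda>e. e 0 \<in> X)" by (rule definable_rel_cong) (rule X_iff[symmetric])
    then show ?thesis using definable_in_if_definable_rel by blast
  qed
qed

end
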